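(* Let $\mu$ and $\nu$ be centered log-concave probability measures on $\mathbb{Z}$, and let $X$ (resp. $Y$) denote a random variable with distribution $\mu$ (resp. $\nu$). Then for all real numbers $1 \leq p \leq q$, $$ W_q^q(\mu, \nu) \leq 2 W_p^p(\mu, \nu) + 8^{q-p} \bigl(2\max\{\mathbb{E}[|X|],\mathbb{E}[|Y|]\} + 1\bigr)^{q-p}\, W_p^p(\mu, \nu) \, \log^{q-p} \left( \frac{2^q(\mathbb{E}[|X|] + \mathbb{E}[|Y|] + 1)^q \sqrt{\Gamma(2q + 1)}}{W_p^p(\mu, \nu)} \right), $$ where the right-hand side is interpreted as $0$ when $W_p(\mu,\nu)=0$.
   Context: A probability measure on $\mathbb{Z}$ with probability mass function $f$ (equivalently, an integer-valued random variable with that distribution) is log-concave if $f(k)^2 \geq f(k-1)f(k+1)$ for all $k \in \mathbb{Z}$ and its support $\{k\in\mathbb{Z} : f(k)>0\}$ is an integer interval (a set of consecutive integers, possibly infinite). It is centered if its mean is $0$. (Log-concave distributions on $\mathbb{Z}$ have finite moments of all orders.) For $p\geq 1$, the $p$-th Wasserstein distance is $W_p(\mu,\nu) = \inf \mathbb{E}[|X-Y|^p]^{1/p}$, where the infimum runs over all couplings $(X,Y)$ with $X$ of distribution $\mu$ and $Y$ of distribution $\nu$. $W_p^p(\mu,\nu)$ means $(W_p(\mu,\nu))^p$, $\log^{s}(x)$ means $(\log x)^s$ with $\log$ the natural logarithm, and $\Gamma$ is the Gamma function. *)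

theory Defs
  imports "HOL-Probability.Probability"
begin

definition log_concave_pmf :: "int pmf \<Rightarrow> bool" where
  "log_concave_pmf \<mu> \<longleftrightarrow>
     (\<forall>k. (pmf \<mu> k)\<^sup>2 \<ge> pmf \<mu> (k - 1) * pmf \<mu> (k + 1)) \<and>
     (\<forall>i\<in>set_pmf \<mu>. \<forall>j\<in>set_pmf \<mu>. {i..j} \<subseteq> set_pmf \<mu>)"

(* Integrability is required because the Bochner integral of a non-integrable function is 0. *)
definition centered_pmf :: "int pmf \<Rightarrow> bool" where
  "centered_pmf \<mu> \<longleftrightarrow>
     integrable (measure_pmf \<mu>) real_of_int \<and> measure_pmf.expectation \<mu> real_of_int = 0"

definition mean_abs :: "int pmf \<Rightarrow> real" where
  "mean_abs \<mu> = measure_pmf.expectation \<mu> (\<lambda>k. \<bar>real_of_int k\<bar>)"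

(* The joint law of a pair of integer random variables is a discrete measure,
   so couplings may be taken to be pmfs on pairs. *)
definition couplings :: "int pmf \<Rightarrow> int pmf \<Rightarrow> (int \<times> int) pmf set" where
  "couplings \<mu> \<nu> = {\<pi>. map_pmf fst \<pi> = \<mu> \<and> map_pmf snd \<pi> = \<nu>}"

(* Real power of an extended nonnegative real; meant for exponents r > 0. *)
definition ennreal_powr :: "ennreal \<Rightarrow> real \<Rightarrow> ennreal" where
  "ennreal_powr x r = (if x = \<infinity> then \<infinity> else ennreal (enn2real x powr r))"

(* Extended-valued: a coupling with infinite p-th moment has infinite cost. *)
definition wasserstein :: "real \<Rightarrow> int pmf \<Rightarrow> int pmf \<Rightarrow> ennreal" where
  "wasserstein p \<mu> \<nu> =
     (INF \<pi>\<in>couplings \<mu> \<nu>.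
        ennreal_powr (\<integral>\<^sup>+ (x, y). ennreal (\<bar>real_of_int (x - y)\<bar> powr p) \<partial>measure_pmf \<pi>) (1 / p))"

end

theory Submission
  imports Defs
begin

text \<open>
  Fix a coupling $(X, Y)$, put $D = |X - Y|$ and let $R \<ge> 0$. Then
  $D^q \<le> R^{q-p} D^p + D^q 1_{D > R}$, and by Cauchy--Schwarz the last term has expectation at
  most $\sqrt{E[D^{2q}]\, P(D > R)}$. Two facts about a centered log-concave integer variable
  control it: \<open>abs_moment_le\<close>, that is $E|X|^r \<le> (2E|X|+1)^r\, \Gamma(r+1)$ for $r \<ge> 2$, and
  \<open>abs_tail_le_exp\<close>, that is $P(|X| > t) \<le> 2 e^{-t/(2(2E|X|+1))}$. With
  $M = 2 \max(E|X|, E|Y|) + 1$ and $N$ the numerator of the fraction inside the logarithm of the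
  theorem, the product of the square roots is at most $2 N e^{-R/(8M)}$. Passing to the infimum over
  couplings gives $W_q^q \<le> R^{q-p} W_p^p + 2 N e^{-R/(8M)}$ for every $R$
  (\<open>wasserstein_interpolation\<close>). The choice $R = 8 M \ln (N / W_p^p)$ turns the last term
  into $2 W_p^p$; if $W_p = 0$, letting $R$ tend to infinity shows $W_q = 0$.

  The two facts concern the tail function $S(k) = P(X \<ge> k)$, which is again log-concave. A
  log-concave sequence crosses a geometric one only once, so among all such tails on the half-line
  with given value at $0$ and given sum the geometric one maximises every sum with increasing
  weights (\<open>increasing_weight_comparison\<close>). The weights $k^r - (k-1)^r$ yield the $r$-th moment of
  the positive part, and the moments of a geometric variable lie below those of an exponential one,
  which produces the Gamma function. The mean that enters is the conditional mean
  $E[X^+]/P(X \<ge> 0)$. It is comparable to $E|X|$ because $P(X \<ge> 0) \<ge> 1/e$, a discrete form of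
  Gruenbaum's inequality (\<open>discrete_gruenbaum\<close>), which follows once more by comparing $S$ with a
  geometric sequence. The exponential tail bound results from the same comparison.
\<close>

section \<open>Tails of log-concave distributions\<close>

abbreviation upper_tail :: "int pmf \<Rightarrow> int \<Rightarrow> real" where
  "upper_tail \<mu> k \<equiv> measure_pmf.prob \<mu> {k..}"

text \<open>The ratio of consecutive values of a log-concave mass function decreases. The support
  condition enters when the outer product is nonzero: then nothing in between vanishes, and the
  local inequalities may be multiplied and cancelled.\<close>

lemma log_concave_pmf_adjacent:
  assumes "log_concave_pmf \<mu>"
  shows "pmf \<mu> i * pmf \<mu> (i + int m + 1) \<le> pmf \<mu> (i + 1) * pmf \<mu> (i + int m)"
proof (induction m)
  case 0
  then show ?case by (simp add: mult.commute)
next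
  case (Suc m)
  let ?f = "pmf \<mu>"
  have "?f i * ?f (i + int m + 2) \<le> ?f (i + 1) * ?f (i + int m + 1)"
  proof (cases "?f i * ?f (i + int m + 2) = 0")
    case True
    then show ?thesis by (metis mult_nonneg_nonneg pmf_nonneg)
  next
    case False
    then have "i \<in> set_pmf \<mu>" "i + int m + 2 \<in> set_pmf \<mu>" by (auto simp: set_pmf_iff)
    then have "{i..i + int m + 2} \<subseteq> set_pmf \<mu>"
      using assms unfolding log_concave_pmf_def by blast
    then have pos: "0 < ?f (i + int m)" "0 < ?f (i + int m + 1)"
      by (auto simp: pmf_positive subset_eq)
    have "?f (i + int m) * ?f (i + int m + 2) \<le> (?f (i + int m + 1))\<^sup>2"
      using assms unfolding log_concave_pmf_def
      by (metis (no_types, lifting) add.assoc add_diff_cancel_right' one_add_one)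
    from mult_mono[OF Suc this]
    have "(?f i * ?f (i + int m + 2)) * (?f (i + int m) * ?f (i + int m + 1))
      \<le> (?f (i + 1) * ?f (i + int m + 1)) * (?f (i + int m) * ?f (i + int m + 1))"
      by (simp add: power2_eq_square algebra_simps)
    then show ?thesis
      by (rule mult_right_le_imp_le) (simp add: pos)
  qed
  then show ?case by (simp add: add_ac)
qed

lemma log_concave_pmf_four_points:
  assumes "log_concave_pmf \<mu>" "i \<le> j"
  shows "pmf \<mu> i * pmf \<mu> (j + int m) \<le> pmf \<mu> (i + int m) * pmf \<mu> j"
proof (induction m)
  case 0
  then show ?case by simp
next
  case (Suc m)
  let ?f = "pmf \<mu>"
  have "?f i * ?f (j + int m + 1) \<le> ?f (i + int m + 1) * ?f j"
  proof (cases "?f i * ?f (j + int m + 1) = 0")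
    case True
    then show ?thesis by (metis mult_nonneg_nonneg pmf_nonneg)
  next
    case False
    then have "i \<in> set_pmf \<mu>" "j + int m + 1 \<in> set_pmf \<mu>" by (auto simp: set_pmf_iff)
    then have "{i..j + int m + 1} \<subseteq> set_pmf \<mu>"
      using assms unfolding log_concave_pmf_def by blast
    then have pos: "0 < ?f (i + int m)" "0 < ?f (j + int m)"
      using assms(2) by (auto simp: pmf_positive subset_eq)
    have "?f (i + int m) * ?f (j + int m + 1) \<le> ?f (i + int m + 1) * ?f (j + int m)"
      using log_concave_pmf_adjacent[OF assms(1), of "i + int m" "nat (j - i)"] assms(2)
      by (simp add: add_ac)
    from mult_mono[OF Suc this]
    have "(?f i * ?f (j + int m + 1)) * (?f (i + int m) * ?f (j + int m))
      \<le> (?f (i + int m + 1) * ?f j) * (?f (i + int m) * ?f (j + int m))"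
      by (simp add: algebra_simps)
    then show ?thesis
      by (rule mult_right_le_imp_le) (simp add: pos)
  qed
  then show ?case by (simp add: add_ac)
qed

lemma upper_tail_step: "upper_tail \<mu> k = pmf \<mu> k + upper_tail \<mu> (k + 1)"
proof -
  have "{k..} = {k} \<union> {k + 1..}" by auto
  then show ?thesis
    by (simp add: measure_pmf.finite_measure_Union measure_pmf_single del: Un_insert_left)
qed

lemma upper_tail_sums: "(\<lambda>n. pmf \<mu> (k + int n)) sums upper_tail \<mu> k"
proof -
  have "(\<lambda>n. measure_pmf.prob \<mu> {k + int n}) sums measure_pmf.prob \<mu> (\<Union>n. {k + int n})"
    by (rule measure_pmf.finite_measure_UNION) (auto simp: disjoint_family_on_def)
  moreover have "(\<Union>n. {k + int n}) = {k..}"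
  proof (safe; simp)
    fix x assume "k \<le> x"
    then show "\<exists>n. x = k + int n" by (intro exI[of _ "nat (x - k)"]) simp
  qed
  ultimately show ?thesis by (simp add: measure_pmf_single)
qed

text \<open>Writing $S(i) = f(i) + S(i+1)$ and likewise for $j$, the claim becomes
  $f(i)\, S(j+1) \<le> S(i+1)\, f(j)$, which is the four-point inequality summed over $m \<ge> 1$.\<close>

lemma upper_tail_log_concave:
  assumes "log_concave_pmf \<mu>" "i \<le> j"
  shows "upper_tail \<mu> i * upper_tail \<mu> (j + 1) \<le> upper_tail \<mu> (i + 1) * upper_tail \<mu> j"
proof -
  have le: "pmf \<mu> i * pmf \<mu> (j + 1 + int n) \<le> pmf \<mu> (i + 1 + int n) * pmf \<mu> j" for n
    using log_concave_pmf_four_points[OF assms, of "Suc n"] by (simp add: add_ac)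
  have "pmf \<mu> i * upper_tail \<mu> (j + 1) \<le> upper_tail \<mu> (i + 1) * pmf \<mu> j"
    by (rule sums_le[OF le sums_mult[OF upper_tail_sums] sums_mult2[OF upper_tail_sums]])
  then show ?thesis
    unfolding upper_tail_step[of \<mu> i] upper_tail_step[of \<mu> j]
    by (simp only: distrib_left distrib_right)
qed

lemma upper_tail_log_concave_nat:
  assumes "log_concave_pmf \<mu>" "i \<le> j"
  shows "upper_tail \<mu> (int i) * upper_tail \<mu> (int (Suc j))
    \<le> upper_tail \<mu> (int (Suc i)) * upper_tail \<mu> (int j)"
  using upper_tail_log_concave[OF assms(1), of "int i" "int j"] assms(2) by (simp add: add.commute)

text \<open>The support is an interval; if it missed $0$ it would lie on one side of $0$, and so
  would the mean. Consequently none of the divisions by $P(X \<ge> 0)$ below is degenerate.\<close>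

lemma centered_pmf_zero_mem_support:
  assumes "log_concave_pmf \<mu>" "centered_pmf \<mu>"
  shows "0 \<in> set_pmf \<mu>"
proof (rule ccontr)
  assume 0: "0 \<notin> set_pmf \<mu>"
  have int: "integrable (measure_pmf \<mu>) real_of_int"
    and mean: "measure_pmf.expectation \<mu> real_of_int = 0"
    using assms(2) by (auto simp: centered_pmf_def)
  have "(\<forall>x\<in>set_pmf \<mu>. 1 \<le> x) \<or> (\<forall>x\<in>set_pmf \<mu>. x \<le> -1)"
  proof (rule ccontr)
    assume "\<not> ?thesis"
    then obtain x y where xy: "x \<in> set_pmf \<mu>" "\<not> 1 \<le> x" "y \<in> set_pmf \<mu>" "\<not> y \<le> -1" by blast
    then have "{x..y} \<subseteq> set_pmf \<mu>" using assms(1) unfolding log_concave_pmf_def by blast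
    with xy 0 show False by (auto simp: subset_eq)
  qed
  then show False
  proof
    assume "\<forall>x\<in>set_pmf \<mu>. 1 \<le> x"
    then have "1 \<le> measure_pmf.expectation \<mu> real_of_int"
      by (intro measure_pmf.integral_ge_const int) (auto simp: AE_measure_pmf_iff)
    with mean show False by simp
  next
    assume "\<forall>x\<in>set_pmf \<mu>. x \<le> -1"
    then have "measure_pmf.expectation \<mu> real_of_int \<le> -1"
      by (intro measure_pmf.integral_le_const int) (force simp: AE_measure_pmf_iff)
    with mean show False by simp
  qed
qed

lemma pmf_reflect: "pmf (map_pmf uminus \<mu>) k = pmf \<mu> (- k)" for \<mu> :: "int pmf"
  using pmf_map_inj'[of uminus \<mu> "- k"] by simp

lemma log_concave_pmf_reflect:
  assumes "log_concave_pmf \<mu>"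
  shows "log_concave_pmf (map_pmf uminus \<mu>)"
  unfolding log_concave_pmf_def
proof (intro conjI allI ballI)
  fix k
  have "pmf \<mu> (- k - 1) * pmf \<mu> (- k + 1) \<le> (pmf \<mu> (- k))\<^sup>2"
    using assms unfolding log_concave_pmf_def by blast
  then show "pmf (map_pmf uminus \<mu>) (k - 1) * pmf (map_pmf uminus \<mu>) (k + 1)
      \<le> (pmf (map_pmf uminus \<mu>) k)\<^sup>2"
    by (simp add: pmf_reflect mult.commute)
next
  fix i j assume "i \<in> set_pmf (map_pmf uminus \<mu>)" "j \<in> set_pmf (map_pmf uminus \<mu>)"
  then have "- i \<in> set_pmf \<mu>" "- j \<in> set_pmf \<mu>" by (auto simp: set_pmf_iff pmf_reflect)
  then have "{- j..- i} \<subseteq> set_pmf \<mu>"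
    using assms unfolding log_concave_pmf_def by blast
  then show "{i..j} \<subseteq> set_pmf (map_pmf uminus \<mu>)"
    by (auto simp: set_pmf_iff pmf_reflect subset_eq simp del: set_map_pmf)
qed

lemma centered_pmf_reflect: "centered_pmf \<mu> \<Longrightarrow> centered_pmf (map_pmf uminus \<mu>)"
  by (simp add: centered_pmf_def)

lemma mean_abs_reflect: "mean_abs (map_pmf uminus \<mu>) = mean_abs \<mu>"
  by (simp add: mean_abs_def)

text \<open>Centering splits $E|X|$ evenly between the positive and the negative part.\<close>

lemma nn_integral_positive_part:
  assumes "centered_pmf \<mu>"
  shows "(\<integral>\<^sup>+x. ennreal (max 0 (real_of_int x)) \<partial>\<mu>) = ennreal (mean_abs \<mu> / 2)"
proof -
  have int: "integrable (measure_pmf \<mu>) real_of_int"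
    and mean: "measure_pmf.expectation \<mu> real_of_int = 0"
    using assms by (auto simp: centered_pmf_def)
  have eq: "max 0 (real_of_int x) = (\<bar>real_of_int x\<bar> + real_of_int x) / 2" for x by auto
  have "(\<integral>\<^sup>+x. ennreal (max 0 (real_of_int x)) \<partial>\<mu>)
      = ennreal (measure_pmf.expectation \<mu> (\<lambda>x. max 0 (real_of_int x)))"
    by (rule nn_integral_eq_integral) (use int in \<open>auto simp: eq\<close>)
  also have "measure_pmf.expectation \<mu> (\<lambda>x. max 0 (real_of_int x)) = mean_abs \<mu> / 2"
    using int mean by (simp add: eq mean_abs_def)
  finally show ?thesis .
qed

lemma mean_abs_nonneg: "0 \<le> mean_abs \<mu>"
  by (simp add: mean_abs_def)

section \<open>Comparison with geometric sequences\<close>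

text \<open>At some step before $k$ the ratio of consecutive terms has dropped below $g$, since
  otherwise $T$ would dominate the geometric sequence at $k$. By log-concavity the ratio then
  remains below $g$ forever.\<close>

lemma below_geometric_stays_below:
  fixes T :: "nat \<Rightarrow> real"
  assumes lc: "\<And>i j. i \<le> j \<Longrightarrow> T i * T (Suc j) \<le> T (Suc i) * T j"
    and nonneg: "\<And>k. 0 \<le> T k" and g: "0 \<le> g" and below: "T k < T 0 * g ^ k" and "k \<le> n"
  shows "T n \<le> T 0 * g ^ n"
proof -
  have "\<exists>j<k. T (Suc j) < g * T j"
  proof (rule ccontr)
    assume "\<not> ?thesis"
    then have step: "g * T j \<le> T (Suc j)" if "j < k" for j using that by force
    have "T 0 * g ^ l \<le> T l" if "l \<le> k" for l
      using that
    proof (induction l)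
      case (Suc l)
      then have "g * (T 0 * g ^ l) \<le> g * T l" using g by (intro mult_left_mono) auto
      with step[of l] Suc.prems show ?case by (simp add: mult_ac)
    qed simp
    with below show False by force
  qed
  then obtain j where j: "j < k" "T (Suc j) < g * T j" by blast
  have pos: "0 < T j" using j(2) nonneg[of "Suc j"] nonneg[of j] by (cases "T j = 0") auto
  have step: "T (Suc i) \<le> g * T i" if "j \<le> i" for i
  proof -
    have "T j * T (Suc i) \<le> T (Suc j) * T i" by (rule lc[OF that])
    also have "\<dots> \<le> (g * T j) * T i" using j(2) nonneg[of i] by (intro mult_right_mono) auto
    finally show ?thesis using pos by (simp add: mult_ac)
  qed
  show ?thesis
    using \<open>k \<le> n\<close>
  proof (induction n rule: dec_induct)
    case base
    then show ?case using below by simp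
  next
    case (step n)
    have "T (Suc n) \<le> g * T n" using step j by (intro \<open>\<And>i. j \<le> i \<Longrightarrow> T (Suc i) \<le> g * T i\<close>) auto
    also have "\<dots> \<le> g * (T 0 * g ^ n)" using step g by (intro mult_left_mono) auto
    finally show ?case by (simp add: mult_ac)
  qed
qed

text \<open>A log-concave sequence crosses a geometric one with the same initial value and the
  same sum at most once, from above to below, so its mass sits at smaller indices and
  nondecreasing weights favour the geometric sequence. This is the tail form of the statement that
  a log-concave law on the naturals is dominated in the increasing convex order by the geometric
  law with its mean.\<close>

lemma increasing_weight_comparison:
  fixes T w :: "nat \<Rightarrow> real"
  assumes lc: "\<And>i j. i \<le> j \<Longrightarrow> T i * T (Suc j) \<le> T (Suc i) * T j"
    and nonneg: "\<And>k. 0 \<le> T k" and g: "0 \<le> g"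
    and w: "mono w" "\<And>k. 0 \<le> w k"
    and eq: "(\<Sum>k. ennreal (T k)) = (\<Sum>k. ennreal (T 0 * g ^ k))"
    and fin: "(\<Sum>k. ennreal (T k)) \<noteq> \<infinity>"
  shows "(\<Sum>k. ennreal (w k * T k)) \<le> (\<Sum>k. ennreal (w k * (T 0 * g ^ k)))"
proof -
  let ?G = "\<lambda>k. T 0 * g ^ k"
  have G: "0 \<le> ?G k" for k using nonneg g by simp
  show ?thesis
  proof (cases "\<exists>k. T k < ?G k")
    case False
    then have ge: "?G k \<le> T k" for k by (simp add: not_less)
    have "(\<Sum>k. ennreal (T k - ?G k)) = (\<Sum>k. ennreal (T k)) - (\<Sum>k. ennreal (?G k))"
      using fin eq G ge nonneg
      by (subst ennreal_suminf_minus[symmetric]) (auto simp: ennreal_minus)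
    also have "\<dots> = 0" using eq fin by (simp add: ennreal_minus_eq_0)
    finally have "ennreal (T k - ?G k) \<le> 0" for k
      using sum_le_suminf[OF summableI, of "{k}" "\<lambda>k. ennreal (T k - ?G k)"] by simp
    then have "ennreal (T k - ?G k) = 0" for k by simp
    then have "T k = ?G k" for k
      by (metis diff_gt_0_iff_gt ennreal_eq_0_iff ge le_less not_less)
    then show ?thesis
      by (intro suminf_le summableI ennreal_leI mult_left_mono eq_refl w)
  next
    case True
    define k0 where "k0 = (LEAST k. T k < ?G k)"
    have k0: "T k0 < ?G k0" unfolding k0_def using True by (rule LeastI_ex)
    \<comment> \<open>Both factors $w(k) - w(k_0)$ and $G(k) - T(k)$ change sign at $k_0$, so their product
      is nonnegative. The four terms are distributed so that no subtraction occurs in the sums,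
      which need not be finite; only the common finite constant $C$ is cancelled afterwards.\<close>
    have cross: "w k * T k + w k0 * ?G k \<le> w k * ?G k + w k0 * T k" for k
    proof (cases "k < k0")
      case True
      then have "?G k \<le> T k" unfolding k0_def using not_less_Least[of k "\<lambda>k. T k < ?G k"] by force
      moreover have "w k \<le> w k0" using w(1) True by (simp add: monoD)
      ultimately have "0 \<le> (w k0 - w k) * (T k - ?G k)" by simp
      then show ?thesis by (simp add: algebra_simps)
    next
      case False
      then have "T k \<le> ?G k"
        using below_geometric_stays_below[OF lc nonneg g k0, of k] by simp
      moreover have "w k0 \<le> w k" using w(1) False by (simp add: monoD)
      ultimately have "0 \<le> (w k - w k0) * (?G k - T k)" by simp
      then show ?thesis by (simp add: algebra_simps)
    qed
    define C where "C = ennreal (w k0) * (\<Sum>k. ennreal (T k))"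
    have split: "ennreal (w k * x + w k0 * y) = ennreal (w k * x) + ennreal (w k0) * ennreal y"
      if "0 \<le> x" "0 \<le> y" for k x y
      using that w(2) by (simp add: ennreal_mult)
    have "(\<Sum>k. ennreal (w k * T k)) + C = (\<Sum>k. ennreal (w k * T k + w k0 * ?G k))"
      unfolding C_def eq split[OF nonneg G] ennreal_suminf_cmult[symmetric]
      by (rule suminf_add) (rule summableI)+
    also have "\<dots> \<le> (\<Sum>k. ennreal (w k * ?G k + w k0 * T k))"
      by (intro suminf_le ennreal_leI cross summableI)
    also have "\<dots> = (\<Sum>k. ennreal (w k * ?G k)) + C"
      unfolding C_def split[OF G nonneg] ennreal_suminf_cmult[symmetric]
      by (rule suminf_add[symmetric]) (rule summableI)+
    finally have "C + (\<Sum>k. ennreal (w k * T k)) \<le> C + (\<Sum>k. ennreal (w k * ?G k))"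
      by (simp add: add.commute)
    moreover have "C \<noteq> \<infinity>" using fin unfolding C_def by (simp add: ennreal_mult_eq_top_iff)
    ultimately show ?thesis by (simp add: ennreal_add_left_cancel_le)
  qed
qed

section \<open>Moments of the positive part\<close>

text \<open>The weights that turn tail sums into power moments. At $k = 0$ the truncated subtraction
  makes the weight $0$, so that the partial sums telescope to $n^r$ from $n = 0$ on.\<close>

abbreviation (input) powr_increment :: "real \<Rightarrow> nat \<Rightarrow> real" where
  "powr_increment r k \<equiv> real k powr r - real (k - 1) powr r"

lemma sum_powr_increment: "(\<Sum>k<Suc n. powr_increment r k) = real n powr r"
  by (induction n) simp_all

lemma powr_increment_nonneg: "0 \<le> r \<Longrightarrow> 0 \<le> powr_increment r k"
  by (simp add: powr_mono2)

lemma mono_powr_increment: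
  assumes "1 \<le> r"
  shows "mono (powr_increment r)"
proof (rule mono_iff_le_Suc[THEN iffD2], rule allI)
  fix k :: nat
  consider "k = 0" | "k = 1" | "2 \<le> k" by linarith
  then show "powr_increment r k \<le> powr_increment r (Suc k)"
  proof cases
    case 1
    then show ?thesis by simp
  next
    case 2
    have "2 powr 1 \<le> (2::real) powr r" using assms by (intro powr_mono) auto
    with 2 show ?thesis by simp
  next
    case 3
    have "((1 - 1/2) *\<^sub>R real (k - 1) + (1/2) *\<^sub>R real (Suc k)) powr r
        \<le> (1 - 1/2) * real (k - 1) powr r + (1/2) * real (Suc k) powr r"
      using 3 by (intro convex_onD[OF powr_convex[OF assms]]) auto
    moreover have "(1 - 1/2) *\<^sub>R real (k - 1) + (1/2) *\<^sub>R real (Suc k) = real k"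
      using 3 by (simp add: of_nat_diff field_simps)
    ultimately show ?thesis by simp
  qed
qed

text \<open>Formulated on an arbitrary measure space because it is used twice: for an integer
  distribution and for the integer part of an exponential variable.\<close>

lemma nn_integral_layer_cake:
  fixes X :: "'a \<Rightarrow> int"
  assumes [measurable]: "X \<in> measurable M (count_space UNIV)" and r: "0 \<le> r"
  shows "(\<integral>\<^sup>+x. ennreal (max 0 (real_of_int (X x)) powr r) \<partial>M)
    = (\<Sum>k. ennreal (powr_increment r k) * emeasure M {x\<in>space M. int k \<le> X x})"
proof -
  have cake: "ennreal (max 0 (real_of_int z) powr r)
    = (\<Sum>k. ennreal (powr_increment r k) * indicator {k. int k \<le> z} k)" for z
  proof -
    have "(\<Sum>k. ennreal (powr_increment r k) * indicator {k. int k \<le> z} k)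
        = (\<Sum>k<nat (z + 1). ennreal (powr_increment r k) * indicator {k. int k \<le> z} k)"
      by (rule suminf_finite) (auto simp: indicator_def)
    also have "\<dots> = (\<Sum>k<nat (z + 1). ennreal (powr_increment r k))"
      by (intro sum.cong) (auto simp: indicator_def)
    also have "\<dots> = ennreal (\<Sum>k<nat (z + 1). powr_increment r k)"
      by (rule sum_ennreal) (rule powr_increment_nonneg[OF r])
    also have "(\<Sum>k<nat (z + 1). powr_increment r k) = max 0 (real_of_int z) powr r"
    proof (cases "0 \<le> z")
      case True
      then have "nat (z + 1) = Suc (nat z)" by simp
      with True show ?thesis by (simp only: sum_powr_increment) simp
    qed simp
    finally show ?thesis by simp
  qed
  have "(\<integral>\<^sup>+x. ennreal (max 0 (real_of_int (X x)) powr r) \<partial>M)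
      = (\<integral>\<^sup>+x. (\<Sum>k. ennreal (powr_increment r k) * indicator {x\<in>space M. int k \<le> X x} x) \<partial>M)"
    unfolding cake by (intro nn_integral_cong suminf_cong) (auto simp: indicator_def)
  also have "\<dots> = (\<Sum>k. \<integral>\<^sup>+x. ennreal (powr_increment r k) * indicator {x\<in>space M. int k \<le> X x} x \<partial>M)"
    by (rule nn_integral_suminf) measurable
  also have "\<dots> = (\<Sum>k. ennreal (powr_increment r k) * emeasure M {x\<in>space M. int k \<le> X x})"
    by (intro suminf_cong nn_integral_cmult_indicator) measurable
  finally show ?thesis .
qed

text \<open>The substitution $t = l x$ in the integral representation of the Gamma function.\<close>

lemma nn_integral_exponential_powr:
  assumes l: "0 < l" and r: "0 \<le> r"
  shows "(\<integral>\<^sup>+x. ennreal (exponential_density l x * x powr r) \<partial>lborel)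
    = ennreal (Gamma (r + 1) / l powr r)"
proof -
  have "(\<integral>\<^sup>+x. ennreal (exponential_density l x * x powr r) \<partial>lborel)
      = ennreal \<bar>1 / l\<bar> * (\<integral>\<^sup>+t. ennreal (exponential_density l (0 + 1 / l * t) * (0 + 1 / l * t) powr r) \<partial>lborel)"
    by (rule nn_integral_real_affine) (use l in auto)
  also have "\<dots> = (\<integral>\<^sup>+t. ennreal (1 / l powr r) *
      ennreal (indicator {0..} t * t powr ((r + 1) - 1) / exp t) \<partial>lborel)"
    using l
    by (subst nn_integral_cmult[symmetric], simp, intro nn_integral_cong)
       (auto simp: exponential_density_def ennreal_mult[symmetric] indicator_def powr_divide
        exp_minus field_simps mult_less_0_iff divide_less_0_iff)
  also have "\<dots> = ennreal (1 / l powr r) * ennreal (Gamma (r + 1))"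
    using r by (subst nn_integral_cmult) (auto simp: Gamma_conv_nn_integral_real)
  also have "\<dots> = ennreal (Gamma (r + 1) / l powr r)"
    using r by (subst ennreal_mult[symmetric]) (auto intro!: less_imp_le Gamma_real_pos)
  finally show ?thesis .
qed

text \<open>The sum is the $r$-th moment of the integer part of an exponential variable of rate
  $l$, hence at most the $r$-th moment of the variable itself.\<close>

lemma geometric_moment_le:
  assumes l: "0 < l" and r: "0 \<le> r"
  shows "(\<Sum>k. ennreal (powr_increment r k) * ennreal (exp (- l) ^ k))
    \<le> ennreal (Gamma (r + 1) / l powr r)"
proof -
  define E where "E = density lborel (exponential_density l)"
  interpret E: prob_space E unfolding E_def by (rule prob_space_exponential_density[OF l])
  have [measurable_cong, simp]: "sets E = sets borel" by (simp add: E_def)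
  have [simp]: "space E = UNIV" by (simp add: E_def)
  have D: "distributed E lborel (\<lambda>x. x) (exponential_density l)"
    unfolding distributed_def by (auto simp: E_def distr_id2)
  have tail: "emeasure E {x\<in>space E. int k \<le> \<lfloor>x\<rfloor>} = ennreal (exp (- l) ^ k)" for k
  proof -
    \<comment> \<open>The tail formula is for the strict inequality; a single point has measure zero.\<close>
    have "AE x in lborel. x \<noteq> real k" by (rule AE_lborel_singleton)
    then have "AE x in E. x \<noteq> real k" unfolding E_def by (subst AE_density) auto
    then have "emeasure E {x\<in>space E. int k \<le> \<lfloor>x\<rfloor>} = emeasure E {x\<in>space E. real k < x}"
      by (intro emeasure_eq_AE) (auto simp: le_floor_iff)
    also have "\<dots> = ennreal (exp (- l) ^ k)"
      using E.exponential_distributedD_gt[OF D, of "real k"] l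
      by (simp add: E.emeasure_eq_measure exp_of_nat_mult[symmetric] mult_ac)
    finally show ?thesis .
  qed
  have "(\<Sum>k. ennreal (powr_increment r k) * ennreal (exp (- l) ^ k))
      = (\<integral>\<^sup>+x. ennreal (max 0 (real_of_int \<lfloor>x\<rfloor>) powr r) \<partial>E)"
    unfolding tail[symmetric] by (rule nn_integral_layer_cake[symmetric]) (use r in measurable)
  also have "\<dots> = (\<integral>\<^sup>+x. ennreal (exponential_density l x * max 0 (real_of_int \<lfloor>x\<rfloor>) powr r) \<partial>lborel)"
    unfolding E_def using l
    by (subst nn_integral_density) (auto simp: ennreal_mult[symmetric] exponential_density_nonneg)
  also have "\<dots> \<le> (\<integral>\<^sup>+x. ennreal (exponential_density l x * x powr r) \<partial>lborel)"
    using l r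
    by (intro nn_integral_mono ennreal_leI)
       (auto simp: exponential_density_def intro!: mult_left_mono powr_mono2)
  also have "\<dots> = ennreal (Gamma (r + 1) / l powr r)"
    by (rule nn_integral_exponential_powr[OF l r])
  finally show ?thesis .
qed

lemma suminf_upper_tail:
  assumes "centered_pmf \<mu>"
  shows "(\<Sum>k. ennreal (upper_tail \<mu> (int k))) = ennreal (upper_tail \<mu> 0 + mean_abs \<mu> / 2)"
proof -
  let ?S = "\<lambda>k. ennreal (upper_tail \<mu> (int k))"
  have tail: "emeasure (measure_pmf \<mu>) {x \<in> space (measure_pmf \<mu>). int k \<le> x} = ?S k" for k
    by (simp add: measure_pmf.emeasure_eq_measure atLeast_def)
  have "(\<Sum>k. ?S k) = (\<Sum>k. (if k = 0 then ?S 0 else 0) + ennreal (powr_increment 1 k) * ?S k)"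
    by (intro suminf_cong) (auto simp: of_nat_diff)
  also have "\<dots> = (\<Sum>k. if k = 0 then ?S 0 else 0) + (\<Sum>k. ennreal (powr_increment 1 k) * ?S k)"
    by (rule suminf_add[symmetric]) (rule summableI)+
  also have "(\<Sum>k. if k = 0 then ?S 0 else 0) = ?S 0"
    using sums_single[of 0 "\<lambda>_. ?S 0"] by (simp add: sums_iff)
  also have "(\<Sum>k. ennreal (powr_increment 1 k) * ?S k)
      = (\<integral>\<^sup>+x. ennreal (max 0 (real_of_int x) powr 1) \<partial>\<mu>)"
    by (subst nn_integral_layer_cake) (simp_all only: tail, simp_all)
  also have "\<dots> = ennreal (mean_abs \<mu> / 2)"
    using nn_integral_positive_part[OF assms] by simp
  finally show ?thesis by (simp add: mean_abs_nonneg)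
qed

text \<open>The geometric law of mean $b$ has tail ratio $b/(1+b)$, and it is compared to an
  exponential law of mean $b + 1/2$. The gain of $1/2$ over the more obvious mean $b + 1$ is needed
  for the final constant. It comes from the first term of
  $\ln x = 2 \sum_n y^{2n+1}/(2n+1)$ with $y = (x-1)/(x+1)$, at $x = (1+b)/b$.\<close>

lemma mean_ratio_le_exp:
  fixes b :: real
  assumes "0 \<le> b"
  shows "b / (1 + b) \<le> exp (- (1 / (b + 1/2)))"
proof (cases "b = 0")
  case False
  with assms have b: "0 < b" by simp
  define x where "x = (1 + b) / b"
  have x: "0 < x" "(x - 1) / (x + 1) = 1 / (1 + 2 * b)"
    using b by (auto simp: x_def field_simps)
  define y where "y = (x - 1) / (x + 1)"
  have y: "0 \<le> y" "2 * y = 1 / (b + 1/2)" using b unfolding y_def x(2) by (auto simp: field_simps)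
  have sums: "(\<lambda>n. 2 * y ^ (2 * n + 1) / real (2 * n + 1)) sums ln x"
    unfolding y_def using ln_series_quadratic[OF x(1)] by simp
  have "sum (\<lambda>n. 2 * y ^ (2 * n + 1) / real (2 * n + 1)) {0} \<le> ln x"
    unfolding sums_unique[OF sums] by (rule sum_le_suminf[OF sums_summable[OF sums]]) (use y in auto)
  then have "1 / (b + 1/2) \<le> ln x" using y by simp
  then have "exp (1 / (b + 1/2)) \<le> x" using x by (simp add: ln_ge_iff)
  then have "inverse x \<le> inverse (exp (1 / (b + 1/2)))" by (intro le_imp_inverse_le) auto
  then show ?thesis using b by (simp add: x_def exp_minus)
qed simp

lemma upper_tail_zero_pos:
  assumes "log_concave_pmf \<mu>" "centered_pmf \<mu>"
  shows "0 < pmf \<mu> 0" "0 < upper_tail \<mu> 0"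
  using centered_pmf_zero_mem_support[OF assms] upper_tail_step[of \<mu> 0]
  by (auto simp: pmf_positive_iff add_pos_nonneg)

text \<open>The tail of $X$ on $k \<ge> 0$ is compared with the geometric sequence of the same sum.
  Here $b = E[X^+] / P(X \<ge> 0)$ is the mean of $X$ conditioned on $X \<ge> 0$, and $g = b/(1+b)$
  is the ratio for which the two sums agree.\<close>

lemma positive_part_moment_le:
  assumes lc: "log_concave_pmf \<mu>" and c: "centered_pmf \<mu>" and r: "1 \<le> r"
  defines "s \<equiv> upper_tail \<mu> 0"
  shows "(\<integral>\<^sup>+x. ennreal (max 0 (real_of_int x) powr r) \<partial>\<mu>)
    \<le> ennreal (s * (mean_abs \<mu> / 2 / s + 1/2) powr r * Gamma (r + 1))"
proof -
  define b where "b = mean_abs \<mu> / 2 / s"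
  define g where "g = b / (1 + b)"
  define l where "l = 1 / (b + 1/2)"
  let ?T = "\<lambda>k. upper_tail \<mu> (int k)"
  have s: "0 < s" unfolding s_def by (rule upper_tail_zero_pos[OF lc c])
  have b: "0 \<le> b" unfolding b_def using s mean_abs_nonneg[of \<mu>] by simp
  have g: "0 \<le> g" "g < 1" using b by (auto simp: g_def)
  have l: "0 < l" using b by (simp add: l_def)
  have gl: "g ^ k \<le> exp (- l) ^ k" for k
    unfolding g_def l_def using b mean_ratio_le_exp[OF b] by (intro power_mono) auto
  have T0: "?T 0 = s" by (simp add: s_def)
  have geom: "(\<Sum>k. ennreal (s * g ^ k)) = ennreal (s + mean_abs \<mu> / 2)"
  proof -
    have "(\<lambda>k. s * g ^ k) sums (s * (1 / (1 - g)))"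
      using g by (intro sums_mult geometric_sums) auto
    also have "s * (1 / (1 - g)) = s + mean_abs \<mu> / 2"
    proof -
      have "1 / (1 - g) = 1 + b" using b by (simp add: g_def field_simps)
      then show ?thesis using s by (simp add: b_def field_simps)
    qed
    finally show ?thesis using s g by (intro suminf_ennreal_eq) auto
  qed
  have "(\<integral>\<^sup>+x. ennreal (max 0 (real_of_int x) powr r) \<partial>\<mu>)
      = (\<Sum>k. ennreal (powr_increment r k) * emeasure \<mu> {x\<in>space \<mu>. int k \<le> x})"
    using r by (intro nn_integral_layer_cake) auto
  also have "\<dots> = (\<Sum>k. ennreal (powr_increment r k * ?T k))"
  proof (rule suminf_cong)
    fix k
    show "ennreal (powr_increment r k) * emeasure \<mu> {x\<in>space \<mu>. int k \<le> x}
      = ennreal (powr_increment r k * ?T k)"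
      using powr_increment_nonneg[of r k] r
      by (subst ennreal_mult) (auto simp: measure_pmf.emeasure_eq_measure atLeast_def)
  qed
  also have "\<dots> \<le> (\<Sum>k. ennreal (powr_increment r k * (?T 0 * g ^ k)))"
  proof (rule increasing_weight_comparison)
    show "?T i * ?T (Suc j) \<le> ?T (Suc i) * ?T j" if "i \<le> j" for i j
      using that by (rule upper_tail_log_concave_nat[OF lc])
    show "(\<Sum>k. ennreal (?T k)) = (\<Sum>k. ennreal (?T 0 * g ^ k))"
      unfolding T0 geom suminf_upper_tail[OF c] by (simp add: s_def)
    show "(\<Sum>k. ennreal (?T k)) \<noteq> \<infinity>"
      by (simp only: suminf_upper_tail[OF c]) simp
    show "mono (powr_increment r)" by (rule mono_powr_increment[OF r])
    show "0 \<le> powr_increment r k" for k using r by (intro powr_increment_nonneg) simp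
  qed (use g in auto)
  also have "\<dots> \<le> (\<Sum>k. ennreal s * (ennreal (powr_increment r k) * ennreal (exp (- l) ^ k)))"
  proof (intro suminf_le summableI)
    fix k
    have "powr_increment r k * (s * g ^ k) \<le> s * (powr_increment r k * exp (- l) ^ k)"
      using gl[of k] s powr_increment_nonneg[of r k] r
      by (subst mult.left_commute) (intro mult_left_mono, auto)
    then show "ennreal (powr_increment r k * (?T 0 * g ^ k))
      \<le> ennreal s * (ennreal (powr_increment r k) * ennreal (exp (- l) ^ k))"
      using s powr_increment_nonneg[of r k] r unfolding T0
      by (simp only: ennreal_mult[symmetric] ennreal_leI less_imp_le mult_nonneg_nonneg
          zero_le_power exp_ge_zero)
  qed
  also have "\<dots> = ennreal s * (\<Sum>k. ennreal (powr_increment r k) * ennreal (exp (- l) ^ k))"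
    by (rule ennreal_suminf_cmult)
  also have "\<dots> \<le> ennreal s * ennreal (Gamma (r + 1) / l powr r)"
    using l r by (intro mult_left_mono geometric_moment_le) auto
  also have "\<dots> = ennreal (s * (b + 1/2) powr r * Gamma (r + 1))"
  proof -
    have "Gamma (r + 1) / l powr r = (b + 1/2) powr r * Gamma (r + 1)"
      using b by (simp add: l_def powr_divide)
    then show ?thesis using s r
      by (simp add: ennreal_mult[symmetric] mult.assoc Gamma_real_pos less_imp_le)
  qed
  finally show ?thesis by (simp add: b_def)
qed

section \<open>Gruenbaum's inequality on the integers\<close>

text \<open>The largest probability of the waiting time for the second success in Bernoulli trials,
  divided by the success probability $u$, is at least $1/e$. With $K = \lfloor 1/u \rfloor$ the
  expression increases in $u$ on $[1/(K+1), 1/K]$, and at the left end $v = 1/(K+1)$ it equals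
  $(K/(K+1))^K \<ge> 1/e$.\<close>

lemma negative_binomial_mode_ge_inverse_exp:
  fixes u :: real
  assumes u: "0 < u" "u \<le> 1"
  obtains K :: nat where "0 < K" "exp (- 1) \<le> real K * u * (1 - u) ^ (K - 1)"
proof -
  define K where "K = nat \<lfloor>1 / u\<rfloor>"
  have "1 \<le> \<lfloor>1 / u\<rfloor>" using u by (simp add: le_floor_iff)
  then have K: "0 < K" and Kfl: "real K = of_int \<lfloor>1 / u\<rfloor>" unfolding K_def by linarith+
  have K1: "real K * u \<le> 1"
    using of_int_floor_le[of "1 / u"] u unfolding Kfl by (simp only: pos_le_divide_eq)
  have K2: "1 \<le> (real K + 1) * u"
  proof -
    have "1 / u \<le> real K + 1" unfolding Kfl by linarith
    then show ?thesis using u by (simp only: pos_divide_le_eq)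
  qed
  define v where "v = 1 / (real K + 1)"
  have v: "0 < v" "v \<le> u" "v < 1" "v \<le> 1/2" "(real K + 1) * v = 1"
    using K K2 by (auto simp: v_def field_simps)
  have Ku: "(real K - 1) * u \<le> 1 - v"
    using K1 v(2) by (simp add: algebra_simps)
  \<comment> \<open>Monotonicity between $v$ and $u$ by Bernoulli, applied to $1 - y = (1-u)/(1-v)$.\<close>
  define y where "y = (u - v) / (1 - v)"
  have y: "0 \<le> y" "y \<le> 1" "1 - y = (1 - u) / (1 - v)"
    using v u by (auto simp: y_def field_simps)
  have "v \<le> u * (1 - (real K - 1) * y)"
  proof -
    have "u * ((real K - 1) * y) = ((real K - 1) * u) * (u - v) / (1 - v)" by (simp add: y_def)
    also have "\<dots> \<le> (1 - v) * (u - v) / (1 - v)"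
      using v Ku by (intro divide_right_mono mult_right_mono) auto
    also have "\<dots> = u - v" using v by simp
    finally show ?thesis by (simp add: algebra_simps)
  qed
  also have "\<dots> \<le> u * (1 - y) ^ (K - 1)"
    using Bernoulli_inequality[of "- y" "K - 1"] K u y by (intro mult_left_mono) (auto simp: of_nat_diff)
  finally have "v * (1 - v) ^ (K - 1) \<le> (u * (1 - y) ^ (K - 1)) * (1 - v) ^ (K - 1)"
    using v by (intro mult_right_mono) auto
  also have "\<dots> = u * (1 - u) ^ (K - 1)"
    using v by (simp add: y(3) power_divide)
  finally have step: "v * (1 - v) ^ (K - 1) \<le> u * (1 - u) ^ (K - 1)" .
  have Kv: "real K * v = 1 - v" using v(5) by (simp add: algebra_simps)
  have "exp (- 1) \<le> (1 - v) ^ K"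
  proof -
    have "1 / (1 - v) = 1 + 1 / real K" using K by (simp add: v_def field_simps)
    also have "\<dots> \<le> exp (1 / real K)" by (rule exp_ge_add_one_self)
    finally have "(1 / (1 - v)) ^ K \<le> exp (1 / real K) ^ K" using v by (intro power_mono) auto
    also have "\<dots> = exp 1" using K by (simp add: exp_of_nat_mult[symmetric])
    finally have "1 \<le> exp 1 * (1 - v) ^ K" using v by (simp add: power_divide field_simps)
    then show ?thesis by (simp add: exp_minus field_simps)
  qed
  also have "(1 - v) ^ K = real K * (v * (1 - v) ^ (K - 1))"
    using K by (cases K) (simp_all add: Kv[symmetric] mult_ac)
  also have "\<dots> \<le> real K * (u * (1 - u) ^ (K - 1))"
    by (rule mult_left_mono[OF step]) simp
  finally show ?thesis using K that[of K] by (simp add: mult_ac)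
qed

lemma sum_upper_tail_le:
  assumes "centered_pmf \<mu>"
  shows "(\<Sum>k<n. upper_tail \<mu> (int k + 1)) \<le> mean_abs \<mu> / 2"
proof -
  have "(\<Sum>k<Suc n. ennreal (upper_tail \<mu> (int k))) \<le> ennreal (upper_tail \<mu> 0 + mean_abs \<mu> / 2)"
    unfolding suminf_upper_tail[OF assms, symmetric] by (rule sum_le_suminf) auto
  then have "ennreal (\<Sum>k<Suc n. upper_tail \<mu> (int k)) \<le> ennreal (upper_tail \<mu> 0 + mean_abs \<mu> / 2)"
    by (simp only: sum_ennreal measure_nonneg)
  then have "(\<Sum>k<Suc n. upper_tail \<mu> (int k)) \<le> upper_tail \<mu> 0 + mean_abs \<mu> / 2"
    by (subst (asm) ennreal_le_iff) (simp_all add: mean_abs_nonneg)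
  then show ?thesis
    by (subst (asm) sum.lessThan_Suc_shift) (simp add: add.commute)
qed

text \<open>Lower tails are upper tails of the reflected law, so every one-sided estimate is
  proved only for the positive part.\<close>

lemma upper_tail_reflect:
  "upper_tail (map_pmf uminus \<mu>) k = 1 - upper_tail \<mu> (1 - k)"
proof -
  have "uminus -` {k..} = - {1 - k..}" by auto
  then show ?thesis
    using measure_pmf.prob_compl[of "{1 - k..}" \<mu>] by (simp add: Compl_eq_Diff_UNIV)
qed

text \<open>A centered log-concave integer variable is nonnegative with probability at least
  $1/e$. With $s = S(0)$ and $\theta = S(1)/S(0)$, log-concavity puts the whole tail function below
  the geometric sequence $s \theta^k$, $k \<in> \int$. On the right this bounds $E[X^+]$ from above
  by $s\theta/(1-\theta)$; on the left it bounds $E[X^-] \<ge> \sum_{j<K} (1 - S(-j))$ from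
  below. As the two expectations are equal, $s \<ge> K (1-\theta) \theta^{K-1}$ for every $K \<ge> 1$.\<close>

lemma discrete_gruenbaum:
  assumes lc: "log_concave_pmf \<mu>" and c: "centered_pmf \<mu>"
  shows "exp (- 1) \<le> upper_tail \<mu> 0"
proof -
  define s where "s = upper_tail \<mu> 0"
  define a where "a = mean_abs \<mu> / 2"
  define u where "u = pmf \<mu> 0 / s"
  define \<theta> where "\<theta> = 1 - u"
  have f0: "0 < pmf \<mu> 0" and s: "0 < s"
    using upper_tail_zero_pos[OF lc c] by (auto simp: s_def)
  have S1: "upper_tail \<mu> 1 = \<theta> * s"
    using upper_tail_step[of \<mu> 0] s by (simp add: \<theta>_def u_def s_def field_simps)
  have \<theta>0: "0 \<le> \<theta>"
  proof -
    have "0 \<le> \<theta> * s" unfolding S1[symmetric] by simp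
    then show ?thesis using s by (simp add: zero_le_mult_iff)
  qed
  have u: "0 < u" "u \<le> 1" using f0 s \<theta>0 by (auto simp: u_def \<theta>_def)
  have right: "upper_tail \<mu> (int k) \<le> s * \<theta> ^ k" for k
  proof (induction k)
    case (Suc k)
    have "s * upper_tail \<mu> (int (Suc k)) \<le> \<theta> * s * upper_tail \<mu> (int k)"
      using upper_tail_log_concave[OF lc, of 0 "int k"] S1 by (simp add: s_def add.commute)
    then have "upper_tail \<mu> (int (Suc k)) \<le> \<theta> * upper_tail \<mu> (int k)"
      using s by (simp add: mult_ac)
    also have "\<dots> \<le> \<theta> * (s * \<theta> ^ k)" using Suc \<theta>0 by (rule mult_left_mono)
    finally show ?case by (simp add: mult_ac)
  qed (simp add: s_def)
  have left: "upper_tail \<mu> (- int j) * \<theta> ^ j \<le> s" for j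
  proof (induction j)
    case (Suc j)
    have "upper_tail \<mu> (- int (Suc j)) * (\<theta> * s) \<le> upper_tail \<mu> (- int j) * s"
      using upper_tail_log_concave[OF lc, of "- int (Suc j)" 0] S1 by (simp add: s_def)
    then have "upper_tail \<mu> (- int (Suc j)) * \<theta> \<le> upper_tail \<mu> (- int j)"
      using s by (simp add: mult.assoc[symmetric])
    then have "upper_tail \<mu> (- int (Suc j)) * \<theta> * \<theta> ^ j \<le> upper_tail \<mu> (- int j) * \<theta> ^ j"
      using \<theta>0 by (intro mult_right_mono) auto
    with Suc show ?case by (simp add: mult_ac)
  qed (simp add: s_def)
  have upper: "s + a \<le> s / u"
  proof -
    have "(\<lambda>k. s * \<theta> ^ k) sums (s * (1 / (1 - \<theta>)))"
      using \<theta>0 u by (intro sums_mult geometric_sums) (simp add: \<theta>_def)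
    then have geom: "(\<lambda>k. s * \<theta> ^ k) sums (s / u)" by (simp add: \<theta>_def)
    have "ennreal (s + a) \<le> (\<Sum>k. ennreal (s * \<theta> ^ k))"
      unfolding s_def a_def suminf_upper_tail[OF c, symmetric]
      by (intro suminf_le summableI ennreal_leI right[unfolded s_def])
    also have "\<dots> = ennreal (s / u)" using geom s \<theta>0 by (intro suminf_ennreal_eq) auto
    finally show ?thesis using s u by (simp add: ennreal_le_iff)
  qed
  obtain K :: nat where K: "0 < K" "exp (- 1) \<le> real K * u * (1 - u) ^ (K - 1)"
    using negative_binomial_mode_ge_inverse_exp[OF u] by blast
  have "(\<Sum>j<K. 1 - upper_tail \<mu> (- int j)) \<le> a"
    using sum_upper_tail_le[OF centered_pmf_reflect[OF c], of K]
    unfolding upper_tail_reflect mean_abs_reflect a_def by simp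
  \<comment> \<open>Multiplying by $\theta^{K-1}$ keeps all exponents nonnegative, as $\theta$ may be $0$
    (when $X$ is constant).\<close>
  then have "\<theta> ^ (K - 1) * (\<Sum>j<K. 1 - upper_tail \<mu> (- int j)) \<le> \<theta> ^ (K - 1) * a"
    using \<theta>0 by (intro mult_left_mono) auto
  moreover have "(\<Sum>j<K. \<theta> ^ (K - 1) - s * \<theta> ^ (K - Suc j))
      \<le> (\<Sum>j<K. \<theta> ^ (K - 1) * (1 - upper_tail \<mu> (- int j)))"
  proof (rule sum_mono)
    fix j assume "j \<in> {..<K}"
    then have "\<theta> ^ (K - 1) = \<theta> ^ j * \<theta> ^ (K - Suc j)"
      by (simp add: power_add[symmetric])
    moreover have "upper_tail \<mu> (- int j) * \<theta> ^ j * \<theta> ^ (K - Suc j) \<le> s * \<theta> ^ (K - Suc j)"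
      using left \<theta>0 by (intro mult_right_mono) auto
    ultimately show "\<theta> ^ (K - 1) - s * \<theta> ^ (K - Suc j) \<le> \<theta> ^ (K - 1) * (1 - upper_tail \<mu> (- int j))"
      by (simp add: algebra_simps)
  qed
  moreover have "(\<Sum>j<K. \<theta> ^ (K - 1) - s * \<theta> ^ (K - Suc j))
      = real K * \<theta> ^ (K - 1) - s * (\<Sum>i<K. \<theta> ^ i)"
    by (simp add: sum_subtractf sum_distrib_left[symmetric] sum.nat_diff_reindex[of "\<lambda>i. \<theta> ^ i"])
  ultimately have "real K * \<theta> ^ (K - 1) \<le> \<theta> ^ (K - 1) * a + s * (\<Sum>i<K. \<theta> ^ i)"
    by (simp add: sum_distrib_left)
  then have "u * (real K * \<theta> ^ (K - 1)) \<le> u * (\<theta> ^ (K - 1) * a + s * (\<Sum>i<K. \<theta> ^ i))"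
    using u by (intro mult_left_mono) auto
  also have "\<dots> = \<theta> ^ (K - 1) * (u * a) + s * (u * (\<Sum>i<K. \<theta> ^ i))"
    by (simp add: algebra_simps)
  also have "u * (\<Sum>i<K. \<theta> ^ i) = 1 - \<theta> ^ K"
    using one_diff_power_eq[of \<theta> K] by (simp add: \<theta>_def)
  also have "\<theta> ^ (K - 1) * (u * a) \<le> \<theta> ^ (K - 1) * (s * \<theta>)"
  proof -
    have "u * a \<le> s * \<theta>" using upper u by (simp add: \<theta>_def field_simps)
    then show ?thesis using \<theta>0 by (intro mult_left_mono) auto
  qed
  also have "\<theta> ^ (K - 1) * (s * \<theta>) + s * (1 - \<theta> ^ K) = s"
    using K(1) by (cases K) (simp_all add: algebra_simps)
  finally have "real K * u * (1 - u) ^ (K - 1) \<le> s" by (simp add: \<theta>_def mult_ac)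
  with K(2) show ?thesis by (simp add: s_def)
qed

text \<open>Gruenbaum's inequality with $e < 2.72$.\<close>

lemma conditional_mean_le:
  assumes "log_concave_pmf \<mu>" "centered_pmf \<mu>"
  shows "mean_abs \<mu> / 2 / upper_tail \<mu> 0 \<le> 272/100 * (mean_abs \<mu> / 2)"
proof -
  have s: "0 < upper_tail \<mu> 0" by (rule upper_tail_zero_pos[OF assms])
  have "1 \<le> exp 1 * upper_tail \<mu> 0"
    using discrete_gruenbaum[OF assms] by (simp add: exp_minus field_simps)
  also have "\<dots> \<le> 272/100 * upper_tail \<mu> 0"
    using e_less_272 s by (intro mult_right_mono) auto
  finally have "mean_abs \<mu> / 2 * 1 \<le> mean_abs \<mu> / 2 * (272/100 * upper_tail \<mu> 0)"
    using mean_abs_nonneg[of \<mu>] by (intro mult_left_mono) auto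
  then show ?thesis using s by (simp add: field_simps)
qed

section \<open>Absolute moments and exponential tails\<close>

text \<open>By Gruenbaum's inequality $b + 1/2 \<le> 2.72\,E|X|/2 + 1/2 \<le> 0.7\,(2E|X|+1)$, and
  $0.7^r \<le> 1/2$ as soon as $r \<ge> 2$. The factor $1/2$ pays for adding the two half-lines.\<close>

lemma positive_part_moment_le_mean_abs:
  assumes lc: "log_concave_pmf \<mu>" and c: "centered_pmf \<mu>" and r: "2 \<le> r"
  shows "(\<integral>\<^sup>+x. ennreal (max 0 (real_of_int x) powr r) \<partial>\<mu>)
    \<le> ennreal ((2 * mean_abs \<mu> + 1) powr r * Gamma (r + 1) / 2)"
proof -
  define s where "s = upper_tail \<mu> 0"
  define b where "b = mean_abs \<mu> / 2 / s"
  define m where "m = 2 * mean_abs \<mu> + 1"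
  have s: "0 < s" "s \<le> 1" using upper_tail_zero_pos[OF lc c] by (auto simp: s_def)
  have b: "0 \<le> b" using s mean_abs_nonneg[of \<mu>] by (simp add: b_def)
  have m: "1 \<le> m" using mean_abs_nonneg[of \<mu>] by (simp add: m_def)
  have "b + 1/2 \<le> 7/10 * m"
    using conditional_mean_le[OF lc c] mean_abs_nonneg[of \<mu>] by (simp add: b_def m_def s_def)
  then have "(b + 1/2) powr r \<le> (7/10 * m) powr r" using b r by (intro powr_mono2) auto
  also have "\<dots> = (7/10) powr r * m powr r" by (rule powr_mult)
  also have "\<dots> \<le> 1/2 * m powr r"
  proof (intro mult_right_mono)
    have "(7/10::real) powr r \<le> (7/10) powr 2" using r by (intro powr_mono') auto
    also have "\<dots> \<le> 1/2" by (simp add: power2_eq_square)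
    finally show "(7/10::real) powr r \<le> 1/2" .
  qed simp
  finally have *: "(b + 1/2) powr r \<le> 1/2 * m powr r" .
  have G: "0 < Gamma (r + 1)" using r by (intro Gamma_real_pos) simp
  have "s * (b + 1/2) powr r * Gamma (r + 1) \<le> 1 * (1/2 * m powr r) * Gamma (r + 1)"
    using s * G by (intro mult_right_mono mult_mono) auto
  then have "ennreal (s * (b + 1/2) powr r * Gamma (r + 1)) \<le> ennreal (m powr r * Gamma (r + 1) / 2)"
    by (intro ennreal_leI) simp
  with positive_part_moment_le[OF lc c, of r] r show ?thesis
    unfolding b_def m_def s_def by (meson one_le_numeral order_trans)
qed

lemma abs_moment_le:
  assumes lc: "log_concave_pmf \<mu>" and c: "centered_pmf \<mu>" and r: "2 \<le> r"
  shows "(\<integral>\<^sup>+x. ennreal (\<bar>real_of_int x\<bar> powr r) \<partial>\<mu>)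
    \<le> ennreal ((2 * mean_abs \<mu> + 1) powr r * Gamma (r + 1))"
proof -
  let ?B = "(2 * mean_abs \<mu> + 1) powr r * Gamma (r + 1) / 2"
  have B: "0 \<le> ?B" using r by (simp add: Gamma_real_pos less_imp_le)
  have "(\<integral>\<^sup>+x. ennreal (\<bar>real_of_int x\<bar> powr r) \<partial>\<mu>)
    = (\<integral>\<^sup>+x. ennreal (max 0 (real_of_int x) powr r) + ennreal (max 0 (real_of_int (- x)) powr r) \<partial>\<mu>)"
    by (intro nn_integral_cong) (auto simp: max_def abs_if)
  also have "\<dots> = (\<integral>\<^sup>+x. ennreal (max 0 (real_of_int x) powr r) \<partial>\<mu>)
      + (\<integral>\<^sup>+x. ennreal (max 0 (real_of_int x) powr r) \<partial>map_pmf uminus \<mu>)"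
    by (subst nn_integral_add) auto
  also have "\<dots> \<le> ennreal ?B + ennreal ?B"
    using positive_part_moment_le_mean_abs[OF log_concave_pmf_reflect[OF lc] centered_pmf_reflect[OF c] r]
    by (intro add_mono positive_part_moment_le_mean_abs[OF lc c r]) (simp only: mean_abs_reflect)
  also have "\<dots> = ennreal ((2 * mean_abs \<mu> + 1) powr r * Gamma (r + 1))"
    using B by (simp only: ennreal_plus[symmetric] field_sum_of_halves)
  finally show ?thesis .
qed

text \<open>If the claim fails at $n$, the tail lies above $S(0) \rho^k$ for all $k \<le> n$. As
  $\rho^n < 1/2$, summing these terms shows that the conditional mean $E[X^+]/S(0)$ exceeds
  $2 E|X| + 1/2$, which contradicts Gruenbaum's inequality.\<close>

lemma upper_tail_le_exp:
  assumes lc: "log_concave_pmf \<mu>" and c: "centered_pmf \<mu>"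
  defines "\<rho> \<equiv> exp (- 1 / (2 * (2 * mean_abs \<mu> + 1)))"
  assumes small: "\<rho> ^ n < 1 / 2"
  shows "upper_tail \<mu> (int n) \<le> upper_tail \<mu> 0 * \<rho> ^ n"
proof (rule ccontr)
  assume large: "\<not> ?thesis"
  define m where "m = 2 * mean_abs \<mu> + 1"
  define s where "s = upper_tail \<mu> 0"
  have m: "1 \<le> m" using mean_abs_nonneg[of \<mu>] by (simp add: m_def)
  have s: "0 < s" unfolding s_def by (rule upper_tail_zero_pos[OF lc c])
  have \<rho>: "0 < \<rho>" "\<rho> < 1" "1 - 1 / (2 * m) \<le> \<rho>"
    using m exp_ge_add_one_self[of "- 1 / (2 * m)"] by (auto simp: \<rho>_def m_def)
  have above: "s * \<rho> ^ k \<le> upper_tail \<mu> (int k)" if "k \<le> n" for k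
  proof (rule ccontr)
    assume "\<not> ?thesis"
    then have "upper_tail \<mu> (int n) \<le> upper_tail \<mu> (int 0) * \<rho> ^ n"
      using \<rho> that
      by (intro below_geometric_stays_below[of "\<lambda>k. upper_tail \<mu> (int k)" \<rho> k n]
          upper_tail_log_concave_nat[OF lc])
         (auto simp: s_def)
    with large show False by simp
  qed
  have "(1 - \<rho>) * (\<Sum>k<n. \<rho> ^ k) = 1 - \<rho> ^ n" by (rule one_diff_power_eq[symmetric])
  with small have "1 / 2 < (1 - \<rho>) * (\<Sum>k<n. \<rho> ^ k)" by simp
  also have "\<dots> \<le> 1 / (2 * m) * (\<Sum>k<n. \<rho> ^ k)"
    using \<rho> by (intro mult_right_mono sum_nonneg) auto
  finally have "m < (\<Sum>k<n. \<rho> ^ k)" using m by (simp add: field_simps)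
  then have "\<rho> * m < \<rho> * (\<Sum>k<n. \<rho> ^ k)" using \<rho> by simp
  moreover have "(1 - 1 / (2 * m)) * m \<le> \<rho> * m" using \<rho> m by (intro mult_right_mono) auto
  ultimately have "m - 1 / 2 < (\<Sum>k<n. \<rho> ^ Suc k)"
    using m by (simp add: sum_distrib_left left_diff_distrib)
  then have "s * (m - 1 / 2) < s * (\<Sum>k<n. \<rho> ^ Suc k)"
    using s by simp
  also have "\<dots> \<le> (\<Sum>k<n. upper_tail \<mu> (int k + 1))"
  proof -
    have "s * \<rho> ^ Suc k \<le> upper_tail \<mu> (int k + 1)" if "k < n" for k
      using above[of "Suc k"] that by (simp add: add.commute)
    then show ?thesis by (auto simp: sum_distrib_left intro!: sum_mono simp del: power_Suc)
  qed
  also have "\<dots> \<le> mean_abs \<mu> / 2" by (rule sum_upper_tail_le[OF c])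
  finally have "m - 1 / 2 < mean_abs \<mu> / 2 / s" using s by (simp add: field_simps)
  also have "\<dots> \<le> 272/100 * (mean_abs \<mu> / 2)" unfolding s_def by (rule conditional_mean_le[OF lc c])
  finally show False using mean_abs_nonneg[of \<mu>] by (simp add: m_def)
qed

text \<open>Adding the two one-sided bounds costs a factor of at most $2$. Where the one-sided bound
  is not available, the right-hand side is at least $1$.\<close>

lemma abs_tail_le_exp:
  assumes lc: "log_concave_pmf \<mu>" and c: "centered_pmf \<mu>"
    and m: "2 * mean_abs \<mu> + 1 \<le> m" and t: "0 \<le> t"
  shows "measure_pmf.prob \<mu> {x. t < \<bar>real_of_int x\<bar>} \<le> 2 * exp (- t / (2 * m))"
proof -
  define n where "n = nat \<lfloor>t\<rfloor> + 1"
  define \<rho> where "\<rho> = exp (- 1 / (2 * (2 * mean_abs \<mu> + 1)))"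
  have m0: "1 \<le> 2 * mean_abs \<mu> + 1" using mean_abs_nonneg[of \<mu>] by simp
  have n: "t \<le> real n" unfolding n_def using t by linarith
  have set: "{x. t < \<bar>real_of_int x\<bar>} = {int n..} \<union> uminus -` {int n..}"
    unfolding n_def using t by (auto simp: floor_less_iff; linarith)
  have "measure_pmf.prob \<mu> {x. t < \<bar>real_of_int x\<bar>} \<le> 2 * \<rho> ^ n"
  proof (cases "\<rho> ^ n < 1 / 2")
    case True
    have "measure_pmf.prob \<mu> {x. t < \<bar>real_of_int x\<bar>}
        \<le> upper_tail \<mu> (int n) + upper_tail (map_pmf uminus \<mu>) (int n)"
      using measure_Un_le[of "{int n..}" \<mu> "uminus -` {int n..}"] by (simp add: set)
    also have "\<dots> \<le> upper_tail \<mu> 0 * \<rho> ^ n + upper_tail (map_pmf uminus \<mu>) 0 * \<rho> ^ n"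
      using True upper_tail_le_exp[OF lc c, of n]
        upper_tail_le_exp[OF log_concave_pmf_reflect[OF lc] centered_pmf_reflect[OF c], of n]
      by (intro add_mono) (simp_all only: mean_abs_reflect \<rho>_def)
    also have "\<dots> \<le> 1 * \<rho> ^ n + 1 * \<rho> ^ n"
      by (intro add_mono mult_right_mono measure_pmf.prob_le_1) (auto simp: \<rho>_def)
    finally show ?thesis by simp
  next
    case False
    then have "1 \<le> 2 * \<rho> ^ n" by simp
    then show ?thesis using measure_pmf.prob_le_1 order_trans by blast
  qed
  also have "\<rho> ^ n = exp (- (real n / (2 * (2 * mean_abs \<mu> + 1))))"
    by (simp add: \<rho>_def exp_of_nat_mult[symmetric])
  also have "\<dots> \<le> exp (- (t / (2 * m)))"
  proof -
    have "t / (2 * m) \<le> real n / (2 * (2 * mean_abs \<mu> + 1))"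
      using n m m0 t by (intro frac_le) auto
    then show ?thesis by simp
  qed
  finally show ?thesis by simp
qed

section \<open>Transport costs of a coupling\<close>

abbreviation transport_cost :: "real \<Rightarrow> (int \<times> int) pmf \<Rightarrow> ennreal" where
  "transport_cost p \<pi> \<equiv> \<integral>\<^sup>+ (x, y). ennreal (\<bar>real_of_int (x - y)\<bar> powr p) \<partial>measure_pmf \<pi>"

lemma ennreal_powr_mono: "0 \<le> r \<Longrightarrow> x \<le> y \<Longrightarrow> ennreal_powr x r \<le> ennreal_powr y r"
  by (auto simp: ennreal_powr_def top_unique less_top intro!: ennreal_leI powr_mono2 enn2real_mono)

lemma ennreal_powr_powr:
  assumes "a \<noteq> 0" "a * b = 1"
  shows "ennreal_powr (ennreal_powr x a) b = x"
  using assms by (cases x) (auto simp: ennreal_powr_def powr_powr)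

lemma ennreal_powr_eq_0: "ennreal_powr x p = 0 \<Longrightarrow> x = 0"
  by (cases x) (auto simp: ennreal_powr_def split: if_splits)

text \<open>The outer power undoes the inner root and commutes with the infimum, because it is an
  increasing bijection of the extended half-line. Hence costs may be compared coupling by
  coupling.\<close>

lemma wasserstein_powr:
  assumes p: "0 < p"
  shows "ennreal_powr (wasserstein p \<mu> \<nu>) p = (INF \<pi>\<in>couplings \<mu> \<nu>. transport_cost p \<pi>)"
proof (rule antisym)
  show "ennreal_powr (wasserstein p \<mu> \<nu>) p \<le> (INF \<pi>\<in>couplings \<mu> \<nu>. transport_cost p \<pi>)"
  proof (rule INF_greatest)
    fix \<pi> assume "\<pi> \<in> couplings \<mu> \<nu>"
    then have "wasserstein p \<mu> \<nu> \<le> ennreal_powr (transport_cost p \<pi>) (1 / p)"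
      unfolding wasserstein_def by (rule INF_lower)
    then have "ennreal_powr (wasserstein p \<mu> \<nu>) p
        \<le> ennreal_powr (ennreal_powr (transport_cost p \<pi>) (1 / p)) p"
      using p by (intro ennreal_powr_mono) auto
    then show "ennreal_powr (wasserstein p \<mu> \<nu>) p \<le> transport_cost p \<pi>"
      using p by (subst (asm) ennreal_powr_powr) auto
  qed
  let ?C = "INF \<pi>\<in>couplings \<mu> \<nu>. transport_cost p \<pi>"
  have "ennreal_powr ?C (1 / p) \<le> wasserstein p \<mu> \<nu>"
    unfolding wasserstein_def using p
    by (intro INF_greatest ennreal_powr_mono INF_lower) auto
  then have "ennreal_powr (ennreal_powr ?C (1 / p)) p \<le> ennreal_powr (wasserstein p \<mu> \<nu>) p"
    using p by (intro ennreal_powr_mono) auto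
  then show "?C \<le> ennreal_powr (wasserstein p \<mu> \<nu>) p"
    using p by (subst (asm) ennreal_powr_powr) auto
qed

lemma powr_le_scaled_powr:
  fixes y :: real
  assumes "0 \<le> y" "0 < \<beta>" "\<beta> \<le> 1" "1 \<le> r"
  shows "y powr r \<le> \<beta> * (y / \<beta>) powr r"
proof -
  have "y powr r = (\<beta> * (y / \<beta>)) powr r" using assms by simp
  also have "\<dots> = \<beta> powr r * (y / \<beta>) powr r" by (rule powr_mult)
  also have "\<dots> \<le> \<beta> powr 1 * (y / \<beta>) powr r"
    using assms by (intro mult_right_mono powr_mono') auto
  finally show ?thesis using assms by simp
qed

text \<open>Convexity of the power function. The cases with a zero argument are separate because
  \<open>powr_convex\<close> concerns the open half-line.\<close>

lemma powr_add_le_weighted: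
  fixes x y :: real
  assumes x: "0 \<le> x" and y: "0 \<le> y" and \<alpha>: "0 < \<alpha>" "\<alpha> < 1" and r: "1 \<le> r"
  shows "(x + y) powr r \<le> \<alpha> * (x / \<alpha>) powr r + (1 - \<alpha>) * (y / (1 - \<alpha>)) powr r"
proof -
  consider "x = 0" | "y = 0" | "0 < x" "0 < y" using x y by linarith
  then show ?thesis
  proof cases
    case 1
    then show ?thesis using powr_le_scaled_powr[OF y, of "1 - \<alpha>" r] \<alpha> r by simp
  next
    case 2
    then show ?thesis using powr_le_scaled_powr[OF x, of \<alpha> r] \<alpha> r by simp
  next
    case 3
    then have "((1 - \<alpha>) *\<^sub>R (y / (1 - \<alpha>)) + \<alpha> *\<^sub>R (x / \<alpha>)) powr r
        \<le> (1 - \<alpha>) * (y / (1 - \<alpha>)) powr r + \<alpha> * (x / \<alpha>) powr r"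
      using \<alpha> by (intro convex_onD[OF powr_convex[OF r]]) auto
    then show ?thesis using \<alpha> by (simp add: add.commute)
  qed
qed

text \<open>Minkowski's inequality in disguise: the weight $\alpha = c_1/c$ is proportional to the
  bound on the norm of $X$, so both summands reproduce the same bound $c^r \Gamma(r+1)$.\<close>

lemma transport_cost_moment_le:
  assumes \<mu>: "log_concave_pmf \<mu>" "centered_pmf \<mu>" and \<nu>: "log_concave_pmf \<nu>" "centered_pmf \<nu>"
    and \<pi>: "\<pi> \<in> couplings \<mu> \<nu>" and r: "2 \<le> r"
  shows "transport_cost r \<pi> \<le> ennreal ((2 * (mean_abs \<mu> + mean_abs \<nu> + 1)) powr r * Gamma (r + 1))"
proof -
  define c1 where "c1 = 2 * mean_abs \<mu> + 1"
  define c2 where "c2 = 2 * mean_abs \<nu> + 1"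
  define c where "c = c1 + c2"
  define \<alpha> where "\<alpha> = c1 / c"
  have pos: "0 < c1" "0 < c2" using mean_abs_nonneg[of \<mu>] mean_abs_nonneg[of \<nu>]
    by (auto simp: c1_def c2_def)
  then have c: "0 < c" by (simp add: c_def)
  have \<alpha>: "0 < \<alpha>" "\<alpha> < 1" "1 - \<alpha> = c2 / c" using pos by (auto simp: \<alpha>_def c_def field_simps)
  have marg: "map_pmf fst \<pi> = \<mu>" "map_pmf snd \<pi> = \<nu>" using \<pi> by (auto simp: couplings_def)
  have G: "0 < Gamma (r + 1)" using r by (intro Gamma_real_pos) simp
  define u where "u = \<alpha> * (1 / \<alpha>) powr r"
  define v where "v = (1 - \<alpha>) * (1 / (1 - \<alpha>)) powr r"
  have uv: "0 \<le> u" "0 \<le> v" using \<alpha>(1,2) by (auto simp: u_def v_def)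
  have bound: "\<bar>real_of_int (x - y)\<bar> powr r
      \<le> u * \<bar>real_of_int x\<bar> powr r + v * \<bar>real_of_int y\<bar> powr r" for x y
  proof -
    have "\<bar>real_of_int (x - y)\<bar> powr r \<le> (\<bar>real_of_int x\<bar> + \<bar>real_of_int y\<bar>) powr r"
      using r by (intro powr_mono2) auto
    also have "\<dots> \<le> \<alpha> * (\<bar>real_of_int x\<bar> / \<alpha>) powr r
        + (1 - \<alpha>) * (\<bar>real_of_int y\<bar> / (1 - \<alpha>)) powr r"
      using \<alpha>(1,2) r by (intro powr_add_le_weighted) auto
    also have "\<dots> = u * \<bar>real_of_int x\<bar> powr r + v * \<bar>real_of_int y\<bar> powr r"
      using \<alpha>(1,2) by (simp add: u_def v_def powr_divide)
    finally show ?thesis .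
  qed
  have "transport_cost r \<pi>
      \<le> (\<integral>\<^sup>+z. ennreal u * ennreal (\<bar>real_of_int (fst z)\<bar> powr r)
            + ennreal v * ennreal (\<bar>real_of_int (snd z)\<bar> powr r) \<partial>\<pi>)"
  proof (rule nn_integral_mono)
    fix z :: "int \<times> int"
    have "ennreal (\<bar>real_of_int (fst z - snd z)\<bar> powr r)
      \<le> ennreal (u * \<bar>real_of_int (fst z)\<bar> powr r + v * \<bar>real_of_int (snd z)\<bar> powr r)"
      by (intro ennreal_leI bound)
    also have "\<dots> = ennreal u * ennreal (\<bar>real_of_int (fst z)\<bar> powr r)
            + ennreal v * ennreal (\<bar>real_of_int (snd z)\<bar> powr r)"
      using uv by (simp add: ennreal_mult)
    finally show "(case z of (x, y) \<Rightarrow> ennreal (\<bar>real_of_int (x - y)\<bar> powr r))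
      \<le> ennreal u * ennreal (\<bar>real_of_int (fst z)\<bar> powr r)
            + ennreal v * ennreal (\<bar>real_of_int (snd z)\<bar> powr r)"
      by (simp add: case_prod_beta)
  qed
  also have "\<dots> = ennreal u * (\<integral>\<^sup>+x. ennreal (\<bar>real_of_int x\<bar> powr r) \<partial>\<mu>)
      + ennreal v * (\<integral>\<^sup>+y. ennreal (\<bar>real_of_int y\<bar> powr r) \<partial>\<nu>)"
    unfolding marg[symmetric] by (simp add: nn_integral_add nn_integral_cmult)
  also have "\<dots> \<le> ennreal u * ennreal (c1 powr r * Gamma (r + 1))
      + ennreal v * ennreal (c2 powr r * Gamma (r + 1))"
    unfolding c1_def c2_def
    by (intro add_mono mult_left_mono abs_moment_le[OF \<mu> r] abs_moment_le[OF \<nu> r]) auto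
  also have "\<dots> = ennreal (u * c1 powr r * Gamma (r + 1) + v * c2 powr r * Gamma (r + 1))"
    using uv G by (simp add: ennreal_mult[symmetric] mult.assoc del: ennreal_plus
        add: ennreal_plus[symmetric])
  also have "u * c1 powr r * Gamma (r + 1) + v * c2 powr r * Gamma (r + 1) = c powr r * Gamma (r + 1)"
  proof -
    have "u * c1 powr r = \<alpha> * (1 / \<alpha> * c1) powr r" by (simp only: u_def powr_mult mult.assoc)
    also have "1 / \<alpha> * c1 = c" using pos c by (simp add: \<alpha>_def)
    finally have "u * c1 powr r = \<alpha> * c powr r" .
    moreover have "v * c2 powr r = (1 - \<alpha>) * (1 / (1 - \<alpha>) * c2) powr r"
      by (simp only: v_def powr_mult mult.assoc)
    moreover have "1 / (1 - \<alpha>) * c2 = c" using pos c by (simp add: \<alpha>(3))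
    ultimately have "u * c1 powr r + v * c2 powr r = c powr r" by (simp add: algebra_simps)
    then show ?thesis by (simp only: distrib_right[symmetric])
  qed
  also have "c = 2 * (mean_abs \<mu> + mean_abs \<nu> + 1)" by (simp add: c_def c1_def c2_def)
  finally show ?thesis .
qed

text \<open>If $|X - Y| > R$ then $|X| > R/2$ or $|Y| > R/2$.\<close>

lemma transport_tail_le:
  assumes \<mu>: "log_concave_pmf \<mu>" "centered_pmf \<mu>" and \<nu>: "log_concave_pmf \<nu>" "centered_pmf \<nu>"
    and \<pi>: "\<pi> \<in> couplings \<mu> \<nu>" and R: "0 \<le> R"
    and M: "2 * mean_abs \<mu> + 1 \<le> M" "2 * mean_abs \<nu> + 1 \<le> M"
  shows "measure_pmf.prob \<pi> {z. R < \<bar>real_of_int (fst z - snd z)\<bar>} \<le> 4 * exp (- R / (4 * M))"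
proof -
  have marg: "map_pmf fst \<pi> = \<mu>" "map_pmf snd \<pi> = \<nu>" using \<pi> by (auto simp: couplings_def)
  let ?A = "fst -` {x. R / 2 < \<bar>real_of_int x\<bar>}" and ?B = "snd -` {x. R / 2 < \<bar>real_of_int x\<bar>}"
  have "measure_pmf.prob \<pi> {z. R < \<bar>real_of_int (fst z - snd z)\<bar>} \<le> measure_pmf.prob \<pi> (?A \<union> ?B)"
    by (intro measure_pmf.finite_measure_mono) auto
  also have "\<dots> \<le> measure_pmf.prob \<pi> ?A + measure_pmf.prob \<pi> ?B"
    by (rule measure_Un_le) auto
  also have "\<dots> = measure_pmf.prob \<mu> {x. R / 2 < \<bar>real_of_int x\<bar>}
      + measure_pmf.prob \<nu> {x. R / 2 < \<bar>real_of_int x\<bar>}"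
    unfolding marg[symmetric] by simp
  also have "\<dots> \<le> 2 * exp (- (R / 2) / (2 * M)) + 2 * exp (- (R / 2) / (2 * M))"
    using R by (intro add_mono abs_tail_le_exp \<mu> \<nu> M) auto
  finally show ?thesis by simp
qed

lemma ennreal_le_of_square_le:
  fixes x :: ennreal
  assumes "x\<^sup>2 \<le> ennreal (y\<^sup>2)" "0 \<le> y"
  shows "x \<le> ennreal y"
proof (cases x)
  case (real r)
  then have "r\<^sup>2 \<le> y\<^sup>2" using assms by (simp add: ennreal_power)
  then have "r \<le> y" using assms(2) by (rule power2_le_imp_le)
  then show ?thesis using real by (simp add: ennreal_leI)
next
  case top
  then show ?thesis using assms by (simp add: top_unique)
qed

text \<open>Cauchy--Schwarz, with the moment of order $2q$ as the first factor.\<close>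

lemma transport_cost_far_le:
  assumes \<mu>: "log_concave_pmf \<mu>" "centered_pmf \<mu>" and \<nu>: "log_concave_pmf \<nu>" "centered_pmf \<nu>"
    and \<pi>: "\<pi> \<in> couplings \<mu> \<nu>" and q: "1 \<le> q"
    and A: "measure_pmf.prob \<pi> A \<le> \<epsilon>\<^sup>2" and \<epsilon>: "0 \<le> \<epsilon>"
  shows "(\<integral>\<^sup>+z. ennreal (\<bar>real_of_int (fst z - snd z)\<bar> powr q) * indicator A z \<partial>\<pi>)
    \<le> ennreal (2 powr q * (mean_abs \<mu> + mean_abs \<nu> + 1) powr q * sqrt (Gamma (2 * q + 1)) * \<epsilon>)"
proof -
  define c where "c = mean_abs \<mu> + mean_abs \<nu> + 1"
  define N where "N = 2 powr q * c powr q * sqrt (Gamma (2 * q + 1))"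
  have G: "0 < Gamma (2 * q + 1)" using q by (intro Gamma_real_pos) simp
  have N: "0 \<le> N" using G by (simp add: N_def)
  have N2: "(2 * c) powr (2 * q) * Gamma (2 * q + 1) = N\<^sup>2"
  proof -
    have "(2 * c) powr (2 * q) = ((2 * c) powr q)\<^sup>2"
      by (simp add: power2_eq_square powr_add[symmetric])
    then show ?thesis using G by (simp add: N_def power_mult_distrib powr_mult)
  qed
  have "(\<integral>\<^sup>+z. ennreal (\<bar>real_of_int (fst z - snd z)\<bar> powr q) * indicator A z \<partial>\<pi>)\<^sup>2
      \<le> (\<integral>\<^sup>+z. (ennreal (\<bar>real_of_int (fst z - snd z)\<bar> powr q))\<^sup>2 \<partial>\<pi>) * (\<integral>\<^sup>+z. (indicator A z)\<^sup>2 \<partial>\<pi>)"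
    by (rule Cauchy_Schwarz_nn_integral) auto
  also have "(\<integral>\<^sup>+z. (ennreal (\<bar>real_of_int (fst z - snd z)\<bar> powr q))\<^sup>2 \<partial>\<pi>) = transport_cost (2 * q) \<pi>"
    by (intro nn_integral_cong)
       (auto simp: ennreal_mult[symmetric] power2_eq_square powr_add[symmetric])
  also have "(\<integral>\<^sup>+z. (indicator A z)\<^sup>2 \<partial>\<pi>) = ennreal (measure_pmf.prob \<pi> A)"
  proof -
    have "(\<integral>\<^sup>+z. (indicator A z)\<^sup>2 \<partial>\<pi>) = (\<integral>\<^sup>+z. indicator A z \<partial>\<pi>)"
      by (intro nn_integral_cong) (simp add: indicator_def)
    then show ?thesis by (simp add: measure_pmf.emeasure_eq_measure)
  qed
  also have "transport_cost (2 * q) \<pi> * ennreal (measure_pmf.prob \<pi> A) \<le> ennreal (N\<^sup>2) * ennreal (\<epsilon>\<^sup>2)"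
    using transport_cost_moment_le[OF \<mu> \<nu> \<pi>, of "2 * q"] q A N2
    by (intro mult_mono ennreal_leI) (auto simp: c_def)
  also have "\<dots> = ennreal ((N * \<epsilon>)\<^sup>2)"
    by (simp add: ennreal_mult[symmetric] power_mult_distrib)
  finally show ?thesis
    unfolding c_def[symmetric] N_def[symmetric]
    by (rule ennreal_le_of_square_le[OF _ mult_nonneg_nonneg[OF N \<epsilon>]])
qed

text \<open>On $|X - Y| \<le> R$ the $q$-th power is at most $R^{q-p}$ times the $p$-th power; the
  remaining part is bounded by the moment and tail estimates.\<close>

lemma transport_cost_interpolation:
  assumes \<mu>: "log_concave_pmf \<mu>" "centered_pmf \<mu>" and \<nu>: "log_concave_pmf \<nu>" "centered_pmf \<nu>"
    and \<pi>: "\<pi> \<in> couplings \<mu> \<nu>" and pq: "1 \<le> p" "p \<le> q" and R: "0 \<le> R"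
    and M: "2 * mean_abs \<mu> + 1 \<le> M" "2 * mean_abs \<nu> + 1 \<le> M"
  defines "N \<equiv> 2 powr q * (mean_abs \<mu> + mean_abs \<nu> + 1) powr q * sqrt (Gamma (2 * q + 1))"
  shows "transport_cost q \<pi> \<le> ennreal (R powr (q - p)) * transport_cost p \<pi>
    + ennreal (2 * N * exp (- R / (8 * M)))"
proof -
  let ?d = "\<lambda>z::int \<times> int. \<bar>real_of_int (fst z - snd z)\<bar>"
  let ?F = "{z. R < ?d z}"
  have split: "ennreal (?d z powr q)
      \<le> ennreal (R powr (q - p)) * ennreal (?d z powr p) + ennreal (?d z powr q) * indicator ?F z" for z
  proof (cases "z \<in> ?F \<or> ?d z = 0")
    case False
    then have "?d z powr q = ?d z powr (q - p) * ?d z powr p"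
      by (simp add: powr_add[symmetric])
    also have "\<dots> \<le> R powr (q - p) * ?d z powr p"
      using False pq by (intro mult_right_mono powr_mono2) auto
    finally show ?thesis using False by (simp add: ennreal_mult[symmetric] ennreal_leI)
  qed auto
  have "exp (- R / (4 * M)) = (exp (- R / (8 * M)))\<^sup>2"
    by (simp add: exp_double[symmetric])
  with transport_tail_le[OF \<mu> \<nu> \<pi> R M]
  have far: "measure_pmf.prob \<pi> ?F \<le> (2 * exp (- R / (8 * M)))\<^sup>2"
    by (simp add: power_mult_distrib)
  have "transport_cost q \<pi> = (\<integral>\<^sup>+z. ennreal (?d z powr q) \<partial>\<pi>)" by (simp add: case_prod_beta')
  also have "\<dots> \<le> (\<integral>\<^sup>+z. ennreal (R powr (q - p)) * ennreal (?d z powr p)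
      + ennreal (?d z powr q) * indicator ?F z \<partial>\<pi>)"
    by (intro nn_integral_mono split)
  also have "\<dots> = ennreal (R powr (q - p)) * (\<integral>\<^sup>+z. ennreal (?d z powr p) \<partial>\<pi>)
      + (\<integral>\<^sup>+z. ennreal (?d z powr q) * indicator ?F z \<partial>\<pi>)"
    by (subst nn_integral_add) (auto simp: nn_integral_cmult)
  also have "\<dots> \<le> ennreal (R powr (q - p)) * (\<integral>\<^sup>+z. ennreal (?d z powr p) \<partial>\<pi>)
      + ennreal (N * (2 * exp (- R / (8 * M))))"
    unfolding N_def using pq by (intro add_left_mono transport_cost_far_le[OF \<mu> \<nu> \<pi> _ far]) auto
  finally show ?thesis by (simp add: case_prod_beta' mult_ac)
qed

text \<open>A nonzero integer has absolute value at least $1$.\<close>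

lemma transport_cost_mono:
  assumes "p \<le> q"
  shows "transport_cost p \<pi> \<le> transport_cost q \<pi>"
proof (rule nn_integral_mono, clarify)
  fix x y :: int
  show "ennreal (\<bar>real_of_int (x - y)\<bar> powr p) \<le> ennreal (\<bar>real_of_int (x - y)\<bar> powr q)"
  proof (cases "x = y")
    case False
    then have "1 \<le> \<bar>real_of_int (x - y)\<bar>" by linarith
    then show ?thesis using assms by (intro ennreal_leI powr_mono)
  qed simp
qed

section \<open>Interpolation between Wasserstein distances\<close>

text \<open>The independent coupling already has a cost below the numerator of the logarithm in
  the theorem, so the logarithm is nonnegative.\<close>

lemma wasserstein_powr_le:
  assumes \<mu>: "log_concave_pmf \<mu>" "centered_pmf \<mu>" and \<nu>: "log_concave_pmf \<nu>" "centered_pmf \<nu>"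
    and pq: "1 \<le> p" "p \<le> q"
  shows "ennreal_powr (wasserstein p \<mu> \<nu>) p
    \<le> ennreal (2 powr q * (mean_abs \<mu> + mean_abs \<nu> + 1) powr q * sqrt (Gamma (2 * q + 1)))"
proof -
  have \<pi>: "pair_pmf \<mu> \<nu> \<in> couplings \<mu> \<nu>"
    by (simp add: couplings_def map_fst_pair_pmf map_snd_pair_pmf)
  have "ennreal_powr (wasserstein p \<mu> \<nu>) p \<le> transport_cost p (pair_pmf \<mu> \<nu>)"
    using pq \<pi> by (subst wasserstein_powr) (auto intro: INF_lower)
  also have "\<dots> \<le> transport_cost q (pair_pmf \<mu> \<nu>)" by (rule transport_cost_mono[OF pq(2)])
  also have "\<dots> \<le> ennreal (2 powr q * (mean_abs \<mu> + mean_abs \<nu> + 1) powr q * sqrt (Gamma (2 * q + 1)))"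
    using transport_cost_far_le[OF \<mu> \<nu> \<pi>, of q UNIV 1] pq by (simp add: case_prod_beta')
  finally show ?thesis .
qed

text \<open>The estimate for a single coupling passes to the infimum along nearly optimal
  couplings.\<close>

lemma wasserstein_interpolation:
  assumes \<mu>: "log_concave_pmf \<mu>" "centered_pmf \<mu>" and \<nu>: "log_concave_pmf \<nu>" "centered_pmf \<nu>"
    and pq: "1 \<le> p" "p \<le> q" and R: "0 \<le> R"
    and M: "2 * mean_abs \<mu> + 1 \<le> M" "2 * mean_abs \<nu> + 1 \<le> M"
  defines "N \<equiv> 2 powr q * (mean_abs \<mu> + mean_abs \<nu> + 1) powr q * sqrt (Gamma (2 * q + 1))"
  shows "ennreal_powr (wasserstein q \<mu> \<nu>) q
    \<le> ennreal (R powr (q - p)) * ennreal_powr (wasserstein p \<mu> \<nu>) p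
      + ennreal (2 * N * exp (- R / (8 * M)))"
proof (rule ennreal_le_epsilon)
  let ?W = "\<lambda>r. INF \<pi>\<in>couplings \<mu> \<nu>. transport_cost r \<pi>"
  let ?T = "ennreal (2 * N * exp (- R / (8 * M)))"
  fix e :: real
  assume fin: "ennreal (R powr (q - p)) * ennreal_powr (wasserstein p \<mu> \<nu>) p + ?T < top" and e: "0 < e"
  define c where "c = R powr (q - p)"
  have c: "0 \<le> c" by (simp add: c_def)
  have Wq: "?W q \<le> ennreal c * transport_cost p \<pi> + ?T" if "\<pi> \<in> couplings \<mu> \<nu>" for \<pi>
    unfolding c_def N_def
    using transport_cost_interpolation[OF \<mu> \<nu> that pq R M] INF_lower[OF that] by (rule order_trans[rotated])
  have "?W q \<le> ennreal c * ?W p + ?T + ennreal e"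
  proof -
    have "?W p < top"
      using le_less_trans[OF wasserstein_powr_le[OF \<mu> \<nu> pq] ennreal_less_top] pq
      by (simp add: wasserstein_powr)
    then obtain w where real: "0 \<le> w" "?W p = ennreal w"
      using less_top_ennreal by blast
    then have "?W p < ennreal (w + e / (c + 1))"
      using e c by (simp add: ennreal_less_iff)
    then obtain \<pi> where \<pi>: "\<pi> \<in> couplings \<mu> \<nu>" "transport_cost p \<pi> < ennreal (w + e / (c + 1))"
      unfolding INF_less_iff by blast
    have "?W q \<le> ennreal c * transport_cost p \<pi> + ?T" by (rule Wq[OF \<pi>(1)])
    also have "\<dots> \<le> ennreal c * ennreal (w + e / (c + 1)) + ?T"
      using \<pi>(2) by (intro add_right_mono mult_left_mono) auto
    also have "ennreal c * ennreal (w + e / (c + 1)) \<le> ennreal (c * w + e)"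
    proof -
      have "c * (e / (c + 1)) \<le> e" using c e by (simp add: field_simps)
      then show ?thesis using c e real
        by (subst ennreal_mult[symmetric]) (auto intro!: ennreal_leI simp: distrib_left)
    qed
    also have "ennreal (c * w + e) = ennreal c * ?W p + ennreal e"
      using c e real by (simp add: ennreal_mult)
    finally show ?thesis by (simp add: add_ac add_right_mono)
  qed
  then show "ennreal_powr (wasserstein q \<mu> \<nu>) q
    \<le> ennreal (R powr (q - p)) * ennreal_powr (wasserstein p \<mu> \<nu>) p + ?T + ennreal e"
    using pq unfolding c_def by (simp add: wasserstein_powr)
qed

theorem theorem3p5:
  fixes \<mu> \<nu> :: "int pmf" and p q :: real
  assumes "log_concave_pmf \<mu>" and "centered_pmf \<mu>"
    and "log_concave_pmf \<nu>" and "centered_pmf \<nu>"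
    and "1 \<le> p" and "p \<le> q"
  shows "ennreal_powr (wasserstein q \<mu> \<nu>) q \<le>
    (let W = enn2real (ennreal_powr (wasserstein p \<mu> \<nu>) p) in
     ennreal (if wasserstein p \<mu> \<nu> = 0 then 0 else
       2 * W +
       8 powr (q - p) * (2 * max (mean_abs \<mu>) (mean_abs \<nu>) + 1) powr (q - p) * W *
       ln (2 powr q * (mean_abs \<mu> + mean_abs \<nu> + 1) powr q * sqrt (Gamma (2 * q + 1)) / W)
         powr (q - p)))"
proof -
  define M where "M = 2 * max (mean_abs \<mu>) (mean_abs \<nu>) + 1"
  define N where "N = 2 powr q * (mean_abs \<mu> + mean_abs \<nu> + 1) powr q * sqrt (Gamma (2 * q + 1))"
  define W where "W = enn2real (ennreal_powr (wasserstein p \<mu> \<nu>) p)"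
  have M: "1 \<le> M" "2 * mean_abs \<mu> + 1 \<le> M" "2 * mean_abs \<nu> + 1 \<le> M"
    using mean_abs_nonneg[of \<mu>] by (auto simp: M_def)
  have N: "0 < N"
    using assms(5,6) mean_abs_nonneg[of \<mu>] mean_abs_nonneg[of \<nu>] by (simp add: N_def Gamma_real_pos)
  have le: "ennreal_powr (wasserstein p \<mu> \<nu>) p \<le> ennreal N"
    unfolding N_def by (rule wasserstein_powr_le[OF assms])
  then have W: "ennreal_powr (wasserstein p \<mu> \<nu>) p = ennreal W" "0 \<le> W" "W \<le> N"
    using N le_less_trans[OF le ennreal_less_top] unfolding W_def by (auto simp: enn2real_leI)
  have main: "ennreal_powr (wasserstein q \<mu> \<nu>) q
      \<le> ennreal (R powr (q - p) * W + 2 * N * exp (- R / (8 * M)))" if "0 \<le> R" for R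
    using wasserstein_interpolation[OF assms that M(2,3)] W N
    unfolding N_def[symmetric] by (simp add: ennreal_mult)
  show ?thesis
  proof (cases "wasserstein p \<mu> \<nu> = 0")
    case True
    then have W0: "W = 0" using assms(5) by (simp add: W_def ennreal_powr_def)
    have "ennreal_powr (wasserstein q \<mu> \<nu>) q \<le> 0"
    proof (rule ennreal_le_epsilon)
      fix e :: real assume e: "0 < e"
      \<comment> \<open>The threshold is free and $R^{q-p}$ is multiplied by $0$, so $R$ may be taken so large
        that the exponential term does not exceed $e$.\<close>
      define R where "R = max 0 (8 * M * ln (2 * N / e))"
      have "ln (2 * N / e) \<le> R / (8 * M)" using M by (simp add: R_def field_simps)
      then have "exp (- R / (8 * M)) \<le> exp (- ln (2 * N / e))" by simp
      also have "\<dots> = e / (2 * N)" using e N by (simp add: exp_minus)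
      finally have "2 * N * exp (- R / (8 * M)) \<le> e" using N by (simp add: field_simps)
      moreover have "0 \<le> R" by (simp add: R_def)
      ultimately show "ennreal_powr (wasserstein q \<mu> \<nu>) q \<le> 0 + ennreal e"
        using main[of R] W0 by (auto intro: order_trans ennreal_leI)
    qed
    then show ?thesis by simp
  next
    case False
    then have "W \<noteq> 0" using W(1) ennreal_powr_eq_0 by fastforce
    with W have Wpos: "0 < W" by simp
    \<comment> \<open>The threshold $R = 8 M L$ is the one for which $2 N e^{-R/(8M)} = 2 W$.\<close>
    define L where "L = ln (N / W)"
    have L: "0 \<le> L" using Wpos W by (simp add: L_def)
    have "exp (- (8 * M * L) / (8 * M)) = exp (- L)" using M by simp
    also have "\<dots> = W / N" using Wpos N by (simp add: L_def exp_minus)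
    finally have far: "2 * N * exp (- (8 * M * L) / (8 * M)) = 2 * W" using N by simp
    have "(8 * M * L) powr (q - p) * W = 8 powr (q - p) * M powr (q - p) * W * L powr (q - p)"
      by (simp add: powr_mult)
    moreover have "0 \<le> 8 * M * L" using M L by simp
    ultimately have "ennreal_powr (wasserstein q \<mu> \<nu>) q
        \<le> ennreal (2 * W + 8 powr (q - p) * M powr (q - p) * W * L powr (q - p))"
      using main[of "8 * M * L"] unfolding far by (simp only: add.commute)
    then show ?thesis
      using False by (simp only: Let_def W_def[symmetric] N_def[symmetric] M_def[symmetric]
          L_def[symmetric] if_False)
  qed
qed

end
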